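(* Let $X$ be a coarse space with $\mathbb{R}_+$-basepoint $i_0\colon\mathbb{R}_+\to X$, and let $n\ge1$. For coarse maps $F,G\colon(c([0,1]^n),c(\partial[0,1]^n))\to(X,i_0[\mathbb{R}_+])$ with $F|_{c(\partial[0,1]^n)}=G|_{c(\partial[0,1]^n)}=i_0\circ p$, define $F*G\colon(c([0,1]^n),c(\partial[0,1]^n))\to(X,i_0[\mathbb{R}_+])$ by $$F*G(x_1,x_2,\dots,x_n,h)=\begin{cases}F(2x_1,x_2,\dots,x_n,h), & x_1\le h/2,\\ G(2x_1-h,x_2,\dots,x_n,h), & h/2<x_1\le h.\end{cases}$$ Then the operation $[F]\cdot[G]=[F*G]$ turns the set $\pi_n^{\mathrm{coarse}}(X,i_0)$ into a group, with unit represented by $i_0\circ p\colon c([0,1]^n)\to X$. Further, $\pi_n^{\mathrm{coarse}}(X,i_0)$ is abelian if $n\ge2$. Moreover, if $k_A\colon A\to X$ is a coarse pair with $\mathbb{R}_+$-basepoint $i_0\colon\mathbb{R}_+\to A$, then for $n\ge2$ the same formula makes sense for $\pi_n^{\mathrm{coarse}}(X,A,i_0)$ and defines a group structure on it, which is abelian if $n\ge3$.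
   Context: A (unital) coarse structure on a set $X$ is a collection of subsets of $X\times X$, called entourages, such that: finite unions of entourages and subsets of entourages are entourages; the union of all entourages is $X\times X$; inverses $M^{-1}=\{(y,x):(x,y)\in M\}$ and compositions $M_1M_2=\{(x,z): (x,y)\in M_1,(y,z)\in M_2\text{ for some }y\}$ of entourages are entourages; the diagonal is an entourage. Maps $f,g\colon S\to X$ are close if $\{(f(s),g(s)):s\in S\}$ is an entourage; $B\subseteq X$ is bounded if its inclusion is close to a constant map. A map $f$ of coarse spaces is controlled if it sends entourages to entourages (via $f[M]=\{(f(x),f(y)):(x,y)\in M\}$), and coarse if moreover inverse images of bounded sets are bounded. A metric space carries the bounded coarse structure: entourages are the subsets of $\{(x,y):d(x,y)<R\}$, $R\in\mathbb{R}$; $\mathbb{R}_+=[0,\infty)$ has this structure. The product of coarse spaces has as entourages the subsets of products $M\times N$ of entourages. For a coarse map $q\colon Z\to\mathbb{R}_+$ let $I_qZ=\{(z,t)\in Z\times\mathbb{R}_+:t\le q(z)+1\}$. A coarse homotopy between coarse maps $f_0,f_1\colon Z\to X$ is a coarse map $H\colon I_qZ\to X$, for some coarse $q$, with $H(z,0)=f_0(z)$, $H(z,q(z)+1)=f_1(z)$. An $\mathbb{R}_+$-basepoint of $X$ is a coarse map $i_0\colon\mathbb{R}_+\to X$. For $Y\subset\mathbb{R}^n$, $c(Y)=\{(hy,h):h\ge0,y\in Y\}\subset\mathbb{R}^n\times\mathbb{R}$ with the induced metric; points of $c([0,1]^n)$ are written $(x_1,\dots,x_n,h)$ with $0\le x_i\le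 h$; $p\colon c([0,1]^n)\to\mathbb{R}_+$ is the height $(x_1,\dots,x_n,h)\mapsto h$. $\pi_n^{\mathrm{coarse}}(X,i_0)$ ($n\ge1$) is the set of classes of coarse maps $F\colon c([0,1]^n)\to X$ with $F|_{c(\partial[0,1]^n)}=i_0\circ p$, modulo coarse homotopies $H\colon I_qc([0,1]^n)\to X$ with $H(z,t)=i_0(p(z))$ for all $z\in c(\partial[0,1]^n)$ and all admissible $t$. A coarse pair $(X,A)$ consists of coarse spaces $X,A$ and a coarse map $k_A\colon A\to X$. With $i_0\colon\mathbb{R}_+\to A$ an $\mathbb{R}_+$-basepoint and $\partial_+[0,1]^n=\{x\in\partial[0,1]^n: x_n>0\}$, $\pi_n^{\mathrm{coarse}}(X,A,i_0)$ is the set of classes of maps of pairs, i.e. coarse maps $F\colon c([0,1]^n)\to X$ together with a coarse map $F_A\colon c(\partial[0,1]^n)\to A$ such that $F|_{c(\partial[0,1]^n)}=k_A\circ F_A$ and $F_A|_{c(\partial_+[0,1]^n)}=i_0\circ p$, modulo coarse homotopies of such maps: coarse maps $H\colon I_qc([0,1]^n)\to X$ together with coarse $H_A\colon I_qc(\partial[0,1]^n)\to A$ compatible via $k_A$, with $H_A(z,t)=i_0(p(z))$ for $z\in c(\partial_+[0,1]^n)$ and all admissible $t$. *)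

theory Defs
  imports Complex_Main "HOL-Algebra.Group"
begin

section \<open>Coarse spaces\<close>

record 'a coarse = "'a partial_object" +
  entourages :: "('a \<times> 'a) set set"

definition coarse_space :: "'a coarse \<Rightarrow> bool" where
  "coarse_space X \<longleftrightarrow>
     (\<forall>M\<in>entourages X. \<forall>N\<in>entourages X. M \<union> N \<in> entourages X) \<and>
     (\<forall>M\<in>entourages X. \<forall>N. N \<subseteq> M \<longrightarrow> N \<in> entourages X) \<and>
     \<Union> (entourages X) = carrier X \<times> carrier X \<and>
     (\<forall>M\<in>entourages X. M\<inverse> \<in> entourages X) \<and>
     (\<forall>M\<in>entourages X. \<forall>N\<in>entourages X. M O N \<in> entourages X) \<and>
     Id_on (carrier X) \<in> entourages X"

definition close_maps :: "'s set \<Rightarrow> 'a coarse \<Rightarrow> ('s \<Rightarrow> 'a) \<Rightarrow> ('s \<Rightarrow> 'a) \<Rightarrow> bool" where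
  "close_maps S X f g \<longleftrightarrow> {(f s, g s) | s. s \<in> S} \<in> entourages X"

definition coarsely_bounded :: "'a coarse \<Rightarrow> 'a set \<Rightarrow> bool" where
  "coarsely_bounded X B \<longleftrightarrow>
     B \<subseteq> carrier X \<and> (\<exists>x\<in>carrier X. close_maps B X (\<lambda>b. b) (\<lambda>_. x))"

definition controlled_map :: "'a coarse \<Rightarrow> 'b coarse \<Rightarrow> ('a \<Rightarrow> 'b) \<Rightarrow> bool" where
  "controlled_map X Y f \<longleftrightarrow>
     f \<in> carrier X \<rightarrow> carrier Y \<and>
     (\<forall>M\<in>entourages X. {(f x, f y) | x y. (x, y) \<in> M} \<in> entourages Y)"

definition coarse_map :: "'a coarse \<Rightarrow> 'b coarse \<Rightarrow> ('a \<Rightarrow> 'b) \<Rightarrow> bool" where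
  "coarse_map X Y f \<longleftrightarrow>
     controlled_map X Y f \<and>
     (\<forall>B. coarsely_bounded Y B \<longrightarrow> coarsely_bounded X {x \<in> carrier X. f x \<in> B})"

definition metric_coarse :: "'a set \<Rightarrow> ('a \<Rightarrow> 'a \<Rightarrow> real) \<Rightarrow> 'a coarse" where
  "metric_coarse S d =
     \<lparr>carrier = S,
      entourages = {M. M \<subseteq> S \<times> S \<and> (\<exists>R. \<forall>(x, y)\<in>M. d x y < R)}\<rparr>"

definition rplus :: "real coarse" where
  "rplus = metric_coarse {0..} dist"

definition coarse_prod :: "'a coarse \<Rightarrow> 'b coarse \<Rightarrow> ('a \<times> 'b) coarse" where
  "coarse_prod X Y =
     \<lparr>carrier = carrier X \<times> carrier Y,
      entourages = {P. \<exists>M\<in>entourages X. \<exists>N\<in>entourages Y.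
        P \<subseteq> {((x, y), (x', y')) | x y x' y'. (x, x') \<in> M \<and> (y, y') \<in> N}}\<rparr>"

definition coarse_subspace :: "'a coarse \<Rightarrow> 'a set \<Rightarrow> 'a coarse" where
  "coarse_subspace X S =
     \<lparr>carrier = S, entourages = {M \<in> entourages X. M \<subseteq> S \<times> S}\<rparr>"

definition coarse_pair :: "'a coarse \<Rightarrow> 'b coarse \<Rightarrow> ('b \<Rightarrow> 'a) \<Rightarrow> bool" where
  "coarse_pair X A k \<longleftrightarrow> coarse_space X \<and> coarse_space A \<and> coarse_map A X k"

section \<open>Coarse homotopies\<close>

definition coarse_cylinder :: "('z \<Rightarrow> real) \<Rightarrow> 'z coarse \<Rightarrow> ('z \<times> real) coarse" where
  "coarse_cylinder q Z =
     coarse_subspace (coarse_prod Z rplus)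
       {(z, t). z \<in> carrier Z \<and> 0 \<le> t \<and> t \<le> q z + 1}"

definition coarse_homotopy ::
  "'z coarse \<Rightarrow> 'a coarse \<Rightarrow> ('z \<Rightarrow> real) \<Rightarrow> ('z \<Rightarrow> 'a) \<Rightarrow> ('z \<Rightarrow> 'a) \<Rightarrow> ('z \<times> real \<Rightarrow> 'a) \<Rightarrow> bool"
where
  "coarse_homotopy Z X q f0 f1 H \<longleftrightarrow>
     coarse_map Z rplus q \<and> coarse_map (coarse_cylinder q Z) X H \<and>
     (\<forall>z\<in>carrier Z. H (z, 0) = f0 z \<and> H (z, q z + 1) = f1 z)"

section \<open>Cones over the cube and its boundary\<close>

text \<open>
  As in \<open>Euclidean_space n\<close> of the analysis library, a vector of $n$-space is a function
  \<open>x :: nat \<Rightarrow> real\<close> vanishing on all indices \<open>\<ge> n\<close>. Indices start at 0, so the usual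
  coordinates $x_1$ and $x_n$ are \<open>x 0\<close> and \<open>x (n - 1)\<close>.
\<close>

type_synonym cone_point = "(nat \<Rightarrow> real) \<times> real"

definition unit_cube :: "nat \<Rightarrow> (nat \<Rightarrow> real) set" where
  "unit_cube n = {x. (\<forall>i<n. 0 \<le> x i \<and> x i \<le> 1) \<and> (\<forall>i\<ge>n. x i = 0)}"

definition cube_boundary :: "nat \<Rightarrow> (nat \<Rightarrow> real) set" where
  "cube_boundary n = {x \<in> unit_cube n. \<exists>i<n. x i = 0 \<or> x i = 1}"

definition cube_boundary_plus :: "nat \<Rightarrow> (nat \<Rightarrow> real) set" where
  "cube_boundary_plus n = {x \<in> cube_boundary n. x (n - 1) > 0}"

definition coarse_cone :: "(nat \<Rightarrow> real) set \<Rightarrow> cone_point set" where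
  "coarse_cone Y = {((\<lambda>i. h * y i), h) | h y. 0 \<le> h \<and> y \<in> Y}"

definition cone_dist :: "nat \<Rightarrow> cone_point \<Rightarrow> cone_point \<Rightarrow> real" where
  "cone_dist n v w = sqrt ((\<Sum>i<n. (fst v i - fst w i)\<^sup>2) + (snd v - snd w)\<^sup>2)"

definition cone_space :: "nat \<Rightarrow> (nat \<Rightarrow> real) set \<Rightarrow> cone_point coarse" where
  "cone_space n Y = metric_coarse (coarse_cone Y) (cone_dist n)"

definition cone_height :: "cone_point \<Rightarrow> real" where
  "cone_height z = snd z"

definition cone_concat :: "(cone_point \<Rightarrow> 'a) \<Rightarrow> (cone_point \<Rightarrow> 'a) \<Rightarrow> cone_point \<Rightarrow> 'a" where
  "cone_concat F G = (\<lambda>(x, h).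
     if x 0 \<le> h / 2 then F (x(0 := 2 * x 0), h) else G (x(0 := 2 * x 0 - h), h))"

section \<open>Coarse homotopy groups\<close>

text \<open>
  The maps that represent classes are extensional (\<open>undefined\<close> off their domain), so that two
  of them are equal exactly if they agree on their domain. The product of two classes is the
  union of the classes of all products of representatives; it is a single class exactly if the
  operation is well defined on classes.
\<close>

definition pi_maps :: "nat \<Rightarrow> 'a coarse \<Rightarrow> (real \<Rightarrow> 'a) \<Rightarrow> (cone_point \<Rightarrow> 'a) set" where
  "pi_maps n X i0 =
     {F \<in> extensional (coarse_cone (unit_cube n)).
        coarse_map (cone_space n (unit_cube n)) X F \<and>
        (\<forall>z\<in>coarse_cone (cube_boundary n). F z = i0 (cone_height z))}"

definition pi_rel ::
  "nat \<Rightarrow> 'a coarse \<Rightarrow> (real \<Rightarrow> 'a) \<Rightarrow> ((cone_point \<Rightarrow> 'a) \<times> (cone_point \<Rightarrow> 'a)) set" where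
  "pi_rel n X i0 =
     {(F, G). F \<in> pi_maps n X i0 \<and> G \<in> pi_maps n X i0 \<and>
        (\<exists>q H. coarse_homotopy (cone_space n (unit_cube n)) X q F G H \<and>
           (\<forall>z\<in>coarse_cone (cube_boundary n). \<forall>t\<in>{0..q z + 1}. H (z, t) = i0 (cone_height z)))}"

definition pi_concat :: "nat \<Rightarrow> (cone_point \<Rightarrow> 'a) \<Rightarrow> (cone_point \<Rightarrow> 'a) \<Rightarrow> cone_point \<Rightarrow> 'a" where
  "pi_concat n F G = restrict (cone_concat F G) (coarse_cone (unit_cube n))"

definition pi_unit :: "nat \<Rightarrow> (real \<Rightarrow> 'a) \<Rightarrow> cone_point \<Rightarrow> 'a" where
  "pi_unit n i0 = restrict (i0 \<circ> cone_height) (coarse_cone (unit_cube n))"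

definition coarse_pi :: "nat \<Rightarrow> 'a coarse \<Rightarrow> (real \<Rightarrow> 'a) \<Rightarrow> (cone_point \<Rightarrow> 'a) set monoid" where
  "coarse_pi n X i0 =
     \<lparr>carrier = pi_maps n X i0 // pi_rel n X i0,
      mult = (\<lambda>a b. \<Union>F\<in>a. \<Union>G\<in>b. pi_rel n X i0 `` {pi_concat n F G}),
      one = pi_rel n X i0 `` {pi_unit n i0}\<rparr>"

text \<open>A map of pairs is a pair \<open>(F, FA)\<close>; here \<open>i0\<close> is a basepoint of \<open>A\<close>.\<close>

type_synonym ('a, 'b) pair_map = "(cone_point \<Rightarrow> 'a) \<times> (cone_point \<Rightarrow> 'b)"

definition rel_pi_maps ::
  "nat \<Rightarrow> 'a coarse \<Rightarrow> 'b coarse \<Rightarrow> ('b \<Rightarrow> 'a) \<Rightarrow> (real \<Rightarrow> 'b) \<Rightarrow> ('a, 'b) pair_map set" where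
  "rel_pi_maps n X A k i0 =
     {(F, FA). F \<in> extensional (coarse_cone (unit_cube n)) \<and>
        FA \<in> extensional (coarse_cone (cube_boundary n)) \<and>
        coarse_map (cone_space n (unit_cube n)) X F \<and>
        coarse_map (cone_space n (cube_boundary n)) A FA \<and>
        (\<forall>z\<in>coarse_cone (cube_boundary n). F z = k (FA z)) \<and>
        (\<forall>z\<in>coarse_cone (cube_boundary_plus n). FA z = i0 (cone_height z))}"

definition rel_pi_rel ::
  "nat \<Rightarrow> 'a coarse \<Rightarrow> 'b coarse \<Rightarrow> ('b \<Rightarrow> 'a) \<Rightarrow> (real \<Rightarrow> 'b) \<Rightarrow>
     (('a, 'b) pair_map \<times> ('a, 'b) pair_map) set" where
  "rel_pi_rel n X A k i0 =
     {((F, FA), (G, GA)).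
        (F, FA) \<in> rel_pi_maps n X A k i0 \<and> (G, GA) \<in> rel_pi_maps n X A k i0 \<and>
        (\<exists>q H HA. coarse_homotopy (cone_space n (unit_cube n)) X q F G H \<and>
           coarse_homotopy (cone_space n (cube_boundary n)) A q FA GA HA \<and>
           (\<forall>z\<in>coarse_cone (cube_boundary n). \<forall>t\<in>{0..q z + 1}. H (z, t) = k (HA (z, t))) \<and>
           (\<forall>z\<in>coarse_cone (cube_boundary_plus n). \<forall>t\<in>{0..q z + 1}.
              HA (z, t) = i0 (cone_height z)))}"

definition rel_pi_concat ::
  "nat \<Rightarrow> ('a, 'b) pair_map \<Rightarrow> ('a, 'b) pair_map \<Rightarrow> ('a, 'b) pair_map" where
  "rel_pi_concat n = (\<lambda>(F, FA) (G, GA).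
     (restrict (cone_concat F G) (coarse_cone (unit_cube n)),
      restrict (cone_concat FA GA) (coarse_cone (cube_boundary n))))"

definition rel_pi_unit :: "nat \<Rightarrow> ('b \<Rightarrow> 'a) \<Rightarrow> (real \<Rightarrow> 'b) \<Rightarrow> ('a, 'b) pair_map" where
  "rel_pi_unit n k i0 =
     (restrict (k \<circ> i0 \<circ> cone_height) (coarse_cone (unit_cube n)),
      restrict (i0 \<circ> cone_height) (coarse_cone (cube_boundary n)))"

definition rel_coarse_pi ::
  "nat \<Rightarrow> 'a coarse \<Rightarrow> 'b coarse \<Rightarrow> ('b \<Rightarrow> 'a) \<Rightarrow> (real \<Rightarrow> 'b) \<Rightarrow> ('a, 'b) pair_map set monoid" where
  "rel_coarse_pi n X A k i0 =
     \<lparr>carrier = rel_pi_maps n X A k i0 // rel_pi_rel n X A k i0,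
      mult = (\<lambda>a b. \<Union>F\<in>a. \<Union>G\<in>b. rel_pi_rel n X A k i0 `` {rel_pi_concat n F G}),
      one = rel_pi_rel n X A k i0 `` {rel_pi_unit n k i0}\<rparr>"

end

theory Submission
  imports Defs
begin

text \<open>
  The proof is the classical one for homotopy groups: associativity and inverses come from
  reparametrizing one cube coordinate, and commutativity from the Eckmann--Hilton interchange of the
  concatenations along two coordinates. Two points are particular to the coarse setting.
  
  \<^item> Concatenated maps need not agree on the seam, only be close there. In the relative case a
  representative is prescribed only where the last coordinate is positive; on a face \<open>x\<^sub>j = 0\<close> or
  \<open>x\<^sub>j = h\<close>, points other than the apex with vanishing last coordinate are left out. But each point of such a face is at
  distance at most 1 from a point where the representative is prescribed, and a controlled map is therefore
  close to the basepoint path on the whole face, even on any neighbourhood of it of fixed width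
  (\<open>cylinder_near_base\<close>, \<open>cylinder_near_face\<close>). Closeness at the seam is enough to glue two coarse maps
  (\<open>height_coarse_glue_via\<close>), which gives concatenations of maps and of homotopies
  (\<open>cylinder_coarse_concat\<close>). The unit laws and inverses produce maps that are only close to the wanted ones, and
  close maps are homotopic by a homotopy that jumps at the last moment (\<open>pair_rel_close\<close>).
  
  \<^item> Cylinders have variable height \<open>q + 1\<close>, so homotopies run at bounded speed and not in unit time. Two
  reparametrizations of a coordinate differ by at most the height \<open>h\<close>; moving from one to the other at
  unit speed takes time at most \<open>h\<close>, which fits into the cylinder with \<open>q\<close> the height function
  (\<open>slide\<close>, \<open>pair_rel_pull\<close>). Composing homotopies in time adds their heights
  (\<open>cylinder_coarse_join\<close>); concatenating homotopies of different heights along a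
  coordinate lets each one stay constant after its own time is up (\<open>concat_height\<close>).
  
  Both groups are treated at once. The set \<open>P\<close> on which a representative is prescribed is a parameter,
  as is the set \<open>J\<close> of coordinates along which concatenation makes sense. The relative case has
  \<open>P\<close> the cone over the positive part of the boundary and \<open>J\<close> all coordinates but the last. The
  absolute case is the pair \<open>(X, X)\<close> with \<open>P\<close> the whole boundary cone, where the
  second component of a map of pairs carries no information. Each statement about a map of pairs
  splits into the same statement on the cube cone with values in \<open>X\<close> and on the boundary cone with
  values in \<open>A\<close>; these are proved once, in the locale \<open>based_domain\<close>.
\<close>

section \<open>Entourages and coarse maps\<close>

lemma entourage_subset:
  "coarse_space Y \<Longrightarrow> M \<in> entourages Y \<Longrightarrow> N \<subseteq> M \<Longrightarrow> N \<in> entourages Y"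
  unfolding coarse_space_def by blast

lemma entourage_Un:
  "coarse_space Y \<Longrightarrow> M \<in> entourages Y \<Longrightarrow> N \<in> entourages Y \<Longrightarrow> M \<union> N \<in> entourages Y"
  unfolding coarse_space_def by simp

lemma entourage_converse:
  "coarse_space Y \<Longrightarrow> M \<in> entourages Y \<Longrightarrow> M\<inverse> \<in> entourages Y"
  unfolding coarse_space_def by blast

lemma entourage_diagonal: "coarse_space Y \<Longrightarrow> Id_on (carrier Y) \<in> entourages Y"
  unfolding coarse_space_def by blast

lemma entourage_comp:
  assumes "coarse_space Y" "M \<in> entourages Y" "N \<in> entourages Y"
    and "\<And>x y. (x, y) \<in> S \<Longrightarrow> \<exists>z. (x, z) \<in> M \<and> (z, y) \<in> N"
  shows "S \<in> entourages Y"
proof -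
  have "M O N \<in> entourages Y" using assms(1-3) unfolding coarse_space_def by blast
  then show ?thesis using assms(1,4) by (elim entourage_subset[rotated]) auto
qed

lemma coarse_map_compose:
  assumes f: "coarse_map Z A f" and k: "coarse_map A X k"
  shows "coarse_map Z X (\<lambda>r. k (f r))"
proof -
  have "{(k (f x), k (f y)) | x y. (x, y) \<in> M} \<in> entourages X" if "M \<in> entourages Z" for M
  proof -
    have "{(f x, f y) | x y. (x, y) \<in> M} \<in> entourages A"
      using f that unfolding coarse_map_def controlled_map_def by blast
    then have "{(k x, k y) | x y. (x, y) \<in> {(f x, f y) | x y. (x, y) \<in> M}} \<in> entourages X"
      using k unfolding coarse_map_def controlled_map_def by blast
    moreover have "{(k x, k y) | x y. (x, y) \<in> {(f x, f y) | x y. (x, y) \<in> M}}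
        = {(k (f x), k (f y)) | x y. (x, y) \<in> M}" by blast
    ultimately show ?thesis by simp
  qed
  moreover have "coarsely_bounded Z {x \<in> carrier Z. k (f x) \<in> B}" if "coarsely_bounded X B" for B
  proof -
    have "coarsely_bounded Z {x \<in> carrier Z. f x \<in> {y \<in> carrier A. k y \<in> B}}"
      using f k that unfolding coarse_map_def by blast
    moreover have "{x \<in> carrier Z. f x \<in> {y \<in> carrier A. k y \<in> B}} = {x \<in> carrier Z. k (f x) \<in> B}"
      using f unfolding coarse_map_def controlled_map_def by auto
    ultimately show ?thesis by simp
  qed
  moreover have "(\<lambda>r. k (f r)) \<in> carrier Z \<rightarrow> carrier X"
    using f k unfolding coarse_map_def controlled_map_def by auto
  ultimately show ?thesis unfolding coarse_map_def controlled_map_def by blast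
qed

section \<open>Coarse maps on domains with a height\<close>

text \<open>
  All domains in sight (the half-line, cones, cylinders over cones) carry a height \<open>\<eta>\<close>
  such that the bounded sets are exactly the sets on which \<open>\<eta>\<close> is bounded above. Properness of a map then only concerns heights, and it is inherited
  by compositions with height-preserving maps and by maps glued from two pieces.
\<close>

definition height_gauge :: "'z set \<Rightarrow> ('z \<Rightarrow> 'z \<Rightarrow> real) \<Rightarrow> ('z \<Rightarrow> real) \<Rightarrow> bool" where
  "height_gauge S d \<eta> \<longleftrightarrow>
     (\<exists>z0\<in>S. \<forall>R. \<exists>R'. \<forall>z\<in>S. \<eta> z \<le> R \<longrightarrow> d z z0 \<le> R') \<and>
     (\<forall>z\<in>S. \<forall>w\<in>S. \<eta> z \<le> \<eta> w + d z w)"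

definition height_coarse ::
  "'z set \<Rightarrow> ('z \<Rightarrow> 'z \<Rightarrow> real) \<Rightarrow> ('z \<Rightarrow> real) \<Rightarrow> 'a coarse \<Rightarrow> ('z \<Rightarrow> 'a) \<Rightarrow> bool" where
  "height_coarse S d \<eta> Y f \<longleftrightarrow>
     (\<forall>x\<in>S. f x \<in> carrier Y) \<and>
     (\<forall>R. {(f x, f y) | x y. x \<in> S \<and> y \<in> S \<and> d x y \<le> R} \<in> entourages Y) \<and>
     (\<forall>B. coarsely_bounded Y B \<longrightarrow> (\<exists>R. \<forall>x\<in>S. f x \<in> B \<longrightarrow> \<eta> x \<le> R))"

lemma coarsely_bounded_metric:
  assumes "height_gauge S d \<eta>"
  shows "coarsely_bounded (metric_coarse S d) B \<longleftrightarrow> B \<subseteq> S \<and> (\<exists>R. \<forall>z\<in>B. \<eta> z \<le> R)"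
proof
  assume "coarsely_bounded (metric_coarse S d) B"
  then obtain x R where B: "B \<subseteq> S" "x \<in> S" "\<forall>s\<in>B. d s x < R"
    unfolding coarsely_bounded_def close_maps_def metric_coarse_def by fastforce
  have "\<forall>z\<in>B. \<eta> z \<le> \<eta> x + R"
    using assms B unfolding height_gauge_def by (smt (verit, best) in_mono)
  then show "B \<subseteq> S \<and> (\<exists>R. \<forall>z\<in>B. \<eta> z \<le> R)" using B by blast
next
  assume B: "B \<subseteq> S \<and> (\<exists>R. \<forall>z\<in>B. \<eta> z \<le> R)"
  then obtain R where R: "\<forall>z\<in>B. \<eta> z \<le> R" by blast
  obtain z0 where z0: "z0 \<in> S" "\<forall>R. \<exists>R'. \<forall>z\<in>S. \<eta> z \<le> R \<longrightarrow> d z z0 \<le> R'"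
    using assms unfolding height_gauge_def by blast
  then obtain R' where "\<forall>z\<in>S. \<eta> z \<le> R \<longrightarrow> d z z0 \<le> R'" by blast
  then have "\<forall>z\<in>B. d z z0 < R' + 1" using R B by (smt (verit) in_mono)
  then show "coarsely_bounded (metric_coarse S d) B"
    using B z0(1) unfolding coarsely_bounded_def close_maps_def metric_coarse_def
    by (auto intro!: bexI[of _ z0])
qed

lemma coarse_map_iff_height_coarse:
  assumes Y: "coarse_space Y" and g: "height_gauge S d \<eta>"
  shows "coarse_map (metric_coarse S d) Y f \<longleftrightarrow> height_coarse S d \<eta> Y f"
proof
  assume f: "coarse_map (metric_coarse S d) Y f"
  then have c: "controlled_map (metric_coarse S d) Y f" unfolding coarse_map_def by blast
  have "{(f x, f y) | x y. x \<in> S \<and> y \<in> S \<and> d x y \<le> R} \<in> entourages Y" for R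
  proof -
    have "{(x, y). x \<in> S \<and> y \<in> S \<and> d x y \<le> R} \<in> entourages (metric_coarse S d)"
      unfolding metric_coarse_def by (auto intro: exI[of _ "R + 1"])
    then show ?thesis using c unfolding controlled_map_def by fastforce
  qed
  moreover have "\<exists>R. \<forall>x\<in>S. f x \<in> B \<longrightarrow> \<eta> x \<le> R" if "coarsely_bounded Y B" for B
  proof -
    have "coarsely_bounded (metric_coarse S d) {x \<in> S. f x \<in> B}"
      using f that unfolding coarse_map_def metric_coarse_def by auto
    then show ?thesis unfolding coarsely_bounded_metric[OF g] by auto
  qed
  ultimately show "height_coarse S d \<eta> Y f"
    using c unfolding height_coarse_def controlled_map_def metric_coarse_def by auto
next
  assume f: "height_coarse S d \<eta> Y f"
  have "{(f x, f y) | x y. (x, y) \<in> M} \<in> entourages Y"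
    if "M \<in> entourages (metric_coarse S d)" for M
  proof -
    obtain R where R: "M \<subseteq> S \<times> S" "\<forall>(x, y)\<in>M. d x y < R"
      using \<open>M \<in> _\<close> unfolding metric_coarse_def by auto
    have "{(f x, f y) | x y. x \<in> S \<and> y \<in> S \<and> d x y \<le> R} \<in> entourages Y"
      using f unfolding height_coarse_def by blast
    then show ?thesis by (rule entourage_subset[OF Y]) (use R in force)
  qed
  moreover have "coarsely_bounded (metric_coarse S d) {x \<in> S. f x \<in> B}"
    if "coarsely_bounded Y B" for B
    using f that unfolding coarsely_bounded_metric[OF g] height_coarse_def by simp blast
  ultimately show "coarse_map (metric_coarse S d) Y f"
    using f unfolding coarse_map_def controlled_map_def height_coarse_def
    by (auto simp: metric_coarse_def)
qed

lemma height_coarse_cong: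
  assumes "height_coarse S d \<eta> Y f" "\<And>x. x \<in> S \<Longrightarrow> f x = g x"
  shows "height_coarse S d \<eta> Y g"
proof -
  have "{(f x, f y) | x y. x \<in> S \<and> y \<in> S \<and> d x y \<le> R} = {(g x, g y) | x y. x \<in> S \<and> y \<in> S \<and> d x y \<le> R}"
    for R using assms(2) by (intro Collect_cong) metis
  then show ?thesis using assms unfolding height_coarse_def by simp
qed

lemma height_coarse_subset:
  assumes "coarse_space Y" "height_coarse S d \<eta> Y f" "T \<subseteq> S"
  shows "height_coarse T d \<eta> Y f"
proof -
  have "{(f x, f y) | x y. x \<in> T \<and> y \<in> T \<and> d x y \<le> R} \<in> entourages Y" for R
    by (rule entourage_subset[OF assms(1), of "{(f x, f y) | x y. x \<in> S \<and> y \<in> S \<and> d x y \<le> R}"])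
      (use assms in \<open>auto simp: height_coarse_def\<close>)
  then show ?thesis using assms(2,3) unfolding height_coarse_def by (meson in_mono)
qed

lemma height_coarse_compose:
  assumes Y: "coarse_space Y" and f: "height_coarse S d \<eta> Y f"
    and mem: "\<And>x. x \<in> S' \<Longrightarrow> \<phi> x \<in> S"
    and ctl: "\<And>R. \<exists>R'. \<forall>x\<in>S'. \<forall>y\<in>S'. d' x y \<le> R \<longrightarrow> d (\<phi> x) (\<phi> y) \<le> R'"
    and ht: "\<And>x. x \<in> S' \<Longrightarrow> \<eta>' x \<le> \<eta> (\<phi> x)"
  shows "height_coarse S' d' \<eta>' Y (\<lambda>x. f (\<phi> x))"
  unfolding height_coarse_def
proof (intro conjI allI ballI impI)
  fix x assume "x \<in> S'" then show "f (\<phi> x) \<in> carrier Y" using f mem unfolding height_coarse_def by blast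
next
  fix R
  obtain R' where R': "\<forall>x\<in>S'. \<forall>y\<in>S'. d' x y \<le> R \<longrightarrow> d (\<phi> x) (\<phi> y) \<le> R'" using ctl by blast
  have "{(f x, f y) | x y. x \<in> S \<and> y \<in> S \<and> d x y \<le> R'} \<in> entourages Y"
    using f unfolding height_coarse_def by blast
  then show "{(f (\<phi> x), f (\<phi> y)) | x y. x \<in> S' \<and> y \<in> S' \<and> d' x y \<le> R} \<in> entourages Y"
    by (rule entourage_subset[OF Y]) (use R' mem in blast)
next
  fix B assume "coarsely_bounded Y B"
  then obtain R where R: "\<forall>x\<in>S. f x \<in> B \<longrightarrow> \<eta> x \<le> R" using f unfolding height_coarse_def by blast
  then show "\<exists>R. \<forall>x\<in>S'. f (\<phi> x) \<in> B \<longrightarrow> \<eta>' x \<le> R" using mem ht by (meson order_trans)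
qed

lemma height_coarse_glue:
  assumes Y: "coarse_space Y" and sym: "\<And>x y. d x y = d y x"
    and f: "height_coarse {x \<in> S. Q x} d \<eta> Y f"
    and g: "height_coarse {x \<in> S. \<not> Q x} d \<eta> Y g"
    and seam: "\<And>R. {(f x, g y) | x y. x \<in> S \<and> y \<in> S \<and> Q x \<and> \<not> Q y \<and> d x y \<le> R} \<in> entourages Y"
  shows "height_coarse S d \<eta> Y (\<lambda>x. if Q x then f x else g x)"
  unfolding height_coarse_def
proof (intro conjI allI ballI impI)
  fix x assume "x \<in> S" then show "(if Q x then f x else g x) \<in> carrier Y"
    using f g unfolding height_coarse_def by auto
next
  fix R
  let ?s = "{(f x, g y) | x y. x \<in> S \<and> y \<in> S \<and> Q x \<and> \<not> Q y \<and> d x y \<le> R}"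
  let ?M = "({(f x, f y) | x y. x \<in> {x \<in> S. Q x} \<and> y \<in> {x \<in> S. Q x} \<and> d x y \<le> R} \<union>
    {(g x, g y) | x y. x \<in> {x \<in> S. \<not> Q x} \<and> y \<in> {x \<in> S. \<not> Q x} \<and> d x y \<le> R}) \<union> (?s \<union> ?s\<inverse>)"
  have "?M \<in> entourages Y"
    using f g unfolding height_coarse_def
    by (intro entourage_Un[OF Y] entourage_converse[OF Y] seam) blast+
  then show "{(if Q x then f x else g x, if Q y then f y else g y) | x y. x \<in> S \<and> y \<in> S \<and> d x y \<le> R}
      \<in> entourages Y"
  proof (rule entourage_subset[OF Y], intro subsetI)
    fix p assume "p \<in> {(if Q x then f x else g x, if Q y then f y else g y) | x y. x \<in> S \<and> y \<in> S \<and> d x y \<le> R}"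
    then obtain x y where "p = (if Q x then f x else g x, if Q y then f y else g y)" "x \<in> S" "y \<in> S" "d x y \<le> R"
      by blast
    moreover have "d y x \<le> R" using \<open>d x y \<le> R\<close> sym[of x y] by simp
    ultimately show "p \<in> ?M" by (cases "Q x"; cases "Q y"; simp) blast+
  qed
next
  fix B assume B: "coarsely_bounded Y B"
  obtain R1 R2 where "\<forall>x\<in>{x \<in> S. Q x}. f x \<in> B \<longrightarrow> \<eta> x \<le> R1" "\<forall>x\<in>{x \<in> S. \<not> Q x}. g x \<in> B \<longrightarrow> \<eta> x \<le> R2"
    using B f g unfolding height_coarse_def by meson
  then have "\<forall>x\<in>S. (if Q x then f x else g x) \<in> B \<longrightarrow> \<eta> x \<le> max R1 R2"
    by (auto simp: le_max_iff_disj)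
  then show "\<exists>R. \<forall>x\<in>S. (if Q x then f x else g x) \<in> B \<longrightarrow> \<eta> x \<le> R" by blast
qed

text \<open>
  For points on different sides of the seam, the path from \<open>f x\<close> to \<open>g y\<close> goes through \<open>c x\<close> and
  \<open>c y\<close>, where \<open>c\<close> is a controlled map that both pieces approach near the seam.
\<close>

lemma height_coarse_glue_via:
  assumes Y: "coarse_space Y" and sym: "\<And>x y. d x y = d y x"
    and f: "height_coarse S d \<eta> Y f"
    and g: "height_coarse {x \<in> S. \<not> Q x} d \<eta> Y g"
    and c: "height_coarse S d \<eta> Y c"
    and fc: "\<And>R. {(f x, c x) | x y. x \<in> S \<and> y \<in> S \<and> Q x \<and> \<not> Q y \<and> d x y \<le> R} \<in> entourages Y"
    and gc: "\<And>R. {(g y, c y) | x y. x \<in> S \<and> y \<in> S \<and> Q x \<and> \<not> Q y \<and> d x y \<le> R} \<in> entourages Y"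
  shows "height_coarse S d \<eta> Y (\<lambda>x. if Q x then f x else g x)"
proof (rule height_coarse_glue[OF Y sym _ g])
  show "height_coarse {x \<in> S. Q x} d \<eta> Y f"
    by (rule height_coarse_subset[OF Y f]) auto
next
  fix R
  let ?c = "{(c x, c y) | x y. x \<in> S \<and> y \<in> S \<and> d x y \<le> R}"
  let ?g = "{(c y, g y) | x y. x \<in> S \<and> y \<in> S \<and> Q x \<and> \<not> Q y \<and> d x y \<le> R}"
  have c': "?c \<in> entourages Y" using c unfolding height_coarse_def by blast
  have g': "?g \<in> entourages Y"
    by (rule entourage_subset[OF Y entourage_converse[OF Y gc[of R]]]) blast
  let ?cg = "{(c x, g y) | x y. x \<in> S \<and> y \<in> S \<and> Q x \<and> \<not> Q y \<and> d x y \<le> R}"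
  have cg: "?cg \<in> entourages Y"
    by (rule entourage_comp[OF Y c' g']) blast
  show "{(f x, g y) | x y. x \<in> S \<and> y \<in> S \<and> Q x \<and> \<not> Q y \<and> d x y \<le> R} \<in> entourages Y"
    by (rule entourage_comp[OF Y fc[of R] cg]) blast
qed

section \<open>Cones and their cylinders\<close>

definition set_coord :: "nat \<Rightarrow> real \<Rightarrow> cone_point \<Rightarrow> cone_point" where
  "set_coord j r z = ((fst z)(j := r), snd z)"

lemma set_coord_simps [simp]:
  "snd (set_coord j r z) = snd z" "fst (set_coord j r z) j = r"
  "i \<noteq> j \<Longrightarrow> fst (set_coord j r z) i = fst z i"
  "set_coord j r (set_coord j s z) = set_coord j r z"
  "set_coord j (fst z j) z = z"
  unfolding set_coord_def by auto

lemma set_coord_commute: "i \<noteq> j \<Longrightarrow> set_coord i r (set_coord j s z) = set_coord j s (set_coord i r z)"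
  unfolding set_coord_def by (simp add: fun_upd_twist)

abbreviation "cube_cone n \<equiv> coarse_cone (unit_cube n)"
abbreviation "boundary_cone n \<equiv> coarse_cone (cube_boundary n)"
abbreviation "boundary_plus_cone n \<equiv> coarse_cone (cube_boundary_plus n)"

lemma cube_cone_iff:
  "z \<in> cube_cone n \<longleftrightarrow> 0 \<le> snd z \<and> (\<forall>i<n. 0 \<le> fst z i \<and> fst z i \<le> snd z) \<and> (\<forall>i\<ge>n. fst z i = 0)"
proof
  assume "z \<in> cube_cone n"
  then show "0 \<le> snd z \<and> (\<forall>i<n. 0 \<le> fst z i \<and> fst z i \<le> snd z) \<and> (\<forall>i\<ge>n. fst z i = 0)"
    unfolding coarse_cone_def unit_cube_def by (auto simp: mult_left_le)
next
  assume z: "0 \<le> snd z \<and> (\<forall>i<n. 0 \<le> fst z i \<and> fst z i \<le> snd z) \<and> (\<forall>i\<ge>n. fst z i = 0)"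
  let ?y = "\<lambda>i. fst z i / snd z"
  have "fst z i = snd z * ?y i" for i using z by (cases "i < n"; cases "snd z = 0") (auto simp: leI intro: antisym)
  then have "z = ((\<lambda>i. snd z * ?y i), snd z)" by (intro prod_eqI ext) simp_all
  moreover have "?y \<in> unit_cube n" using z unfolding unit_cube_def by (auto simp: divide_le_eq_1)
  ultimately show "z \<in> cube_cone n" unfolding coarse_cone_def mem_Collect_eq using z by metis
qed

lemma boundary_cone_iff:
  assumes "n \<ge> 1"
  shows "z \<in> boundary_cone n \<longleftrightarrow> z \<in> cube_cone n \<and> (\<exists>i<n. fst z i = 0 \<or> fst z i = snd z)"
proof
  assume "z \<in> boundary_cone n"
  then show "z \<in> cube_cone n \<and> (\<exists>i<n. fst z i = 0 \<or> fst z i = snd z)"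
    unfolding coarse_cone_def cube_boundary_def by auto
next
  assume "z \<in> cube_cone n \<and> (\<exists>i<n. fst z i = 0 \<or> fst z i = snd z)"
  then obtain h y i where z: "z = ((\<lambda>i. h * y i), h)" "0 \<le> h" "y \<in> unit_cube n"
    "i < n" "h * y i = 0 \<or> h * y i = h"
    unfolding coarse_cone_def by auto
  show "z \<in> boundary_cone n"
  proof (cases "h = 0")
    case True
    have "(\<lambda>_. 0) \<in> cube_boundary n" using assms unfolding cube_boundary_def unit_cube_def
      by (auto intro!: exI[of _ 0])
    then show ?thesis using True z unfolding coarse_cone_def by force
  next
    case False
    then have "y \<in> cube_boundary n" using z unfolding cube_boundary_def by auto
    then show ?thesis using z unfolding coarse_cone_def by blast
  qed
qed

text \<open>The apex lies in the cone over any nonempty set, so height 0 is a case of its own.\<close>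

lemma boundary_plus_cone_iff:
  assumes "n \<ge> 1"
  shows "z \<in> boundary_plus_cone n \<longleftrightarrow> z \<in> boundary_cone n \<and> (fst z (n - 1) > 0 \<or> snd z = 0)"
proof
  assume "z \<in> boundary_plus_cone n"
  then show "z \<in> boundary_cone n \<and> (fst z (n - 1) > 0 \<or> snd z = 0)"
    unfolding coarse_cone_def cube_boundary_plus_def by auto
next
  assume "z \<in> boundary_cone n \<and> (fst z (n - 1) > 0 \<or> snd z = 0)"
  then obtain h y where z: "z = ((\<lambda>i. h * y i), h)" "0 \<le> h" "y \<in> cube_boundary n"
    "h * y (n - 1) > 0 \<or> h = 0"
    unfolding coarse_cone_def by auto
  show "z \<in> boundary_plus_cone n"
  proof (cases "h = 0")
    case True
    have "(\<lambda>i. if i < n then 1 else 0) \<in> cube_boundary_plus n"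
      using assms unfolding cube_boundary_plus_def cube_boundary_def unit_cube_def
      by (auto intro!: exI[of _ 0])
    then show ?thesis using True z unfolding coarse_cone_def by force
  next
    case False
    then have "y \<in> cube_boundary_plus n"
      using z unfolding cube_boundary_plus_def by (auto simp: zero_less_mult_iff)
    then show ?thesis using z unfolding coarse_cone_def by blast
  qed
qed

lemma cone_dist_sym: "cone_dist n v w = cone_dist n w v"
  unfolding cone_dist_def by (simp add: power2_commute)

lemma cone_dist_nonneg: "0 \<le> cone_dist n v w"
  unfolding cone_dist_def by (simp add: sum_nonneg)

lemma cone_dist_self [simp]: "cone_dist n v v = 0"
  unfolding cone_dist_def by simp

lemma height_le_cone_dist: "\<bar>snd v - snd w\<bar> \<le> cone_dist n v w"
  unfolding cone_dist_def by (rule real_le_rsqrt) (simp add: sum_nonneg)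

lemma coord_le_cone_dist:
  assumes "i < n"
  shows "\<bar>fst v i - fst w i\<bar> \<le> cone_dist n v w"
proof -
  have "(fst v i - fst w i)\<^sup>2 \<le> (\<Sum>i<n. (fst v i - fst w i)\<^sup>2)"
    using assms by (intro member_le_sum) auto
  then show ?thesis unfolding cone_dist_def by (intro real_le_rsqrt) (simp add: add_increasing2)
qed

lemma cone_dist_set_coord:
  "cone_dist n (set_coord j r v) (set_coord j s w) \<le> cone_dist n v w + \<bar>r - s\<bar>"
proof -
  let ?S = "(\<Sum>i<n. (fst v i - fst w i)\<^sup>2) + (snd v - snd w)\<^sup>2"
  have "(\<Sum>i<n. (fst (set_coord j r v) i - fst (set_coord j s w) i)\<^sup>2)
      \<le> (\<Sum>i<n. (fst v i - fst w i)\<^sup>2 + (if i = j then (r - s)\<^sup>2 else 0))"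
    by (intro sum_mono) (auto simp: set_coord_def)
  also have "\<dots> \<le> (\<Sum>i<n. (fst v i - fst w i)\<^sup>2) + (r - s)\<^sup>2"
    by (simp add: sum.distrib)
  finally have "cone_dist n (set_coord j r v) (set_coord j s w) \<le> sqrt (?S + (r - s)\<^sup>2)"
    unfolding cone_dist_def by simp
  also have "\<dots> \<le> sqrt ?S + sqrt ((r - s)\<^sup>2)"
    by (rule sqrt_add_le_add_sqrt) (simp_all add: sum_nonneg)
  finally show ?thesis unfolding cone_dist_def by simp
qed

lemma cone_dist_origin:
  assumes "z \<in> cube_cone n"
  shows "cone_dist n z (\<lambda>_. 0, 0) \<le> (real n + 1) * snd z"
proof -
  have z: "0 \<le> snd z" "\<And>i. i < n \<Longrightarrow> 0 \<le> fst z i \<and> fst z i \<le> snd z" using assms cube_cone_iff by auto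
  have "(\<Sum>i<n. (fst z i)\<^sup>2) \<le> (\<Sum>i<n. (snd z)\<^sup>2)"
    using z by (intro sum_mono power_mono) auto
  then have "(\<Sum>i<n. (fst z i)\<^sup>2) + (snd z)\<^sup>2 \<le> (real n + 1) * (snd z)\<^sup>2" by (simp add: algebra_simps)
  also have "\<dots> \<le> (real n + 1)\<^sup>2 * (snd z)\<^sup>2"
    by (intro mult_right_mono) (auto simp: power2_eq_square)
  finally show ?thesis unfolding cone_dist_def using z
    by (intro real_le_lsqrt) (auto simp: power_mult_distrib)
qed

definition cylinder :: "cone_point set \<Rightarrow> (cone_point \<Rightarrow> real) \<Rightarrow> (cone_point \<times> real) set" where
  "cylinder D q = {(z, t). z \<in> D \<and> 0 \<le> t \<and> t \<le> q z + 1}"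

definition cylinder_dist :: "nat \<Rightarrow> cone_point \<times> real \<Rightarrow> cone_point \<times> real \<Rightarrow> real" where
  "cylinder_dist n u v = max (cone_dist n (fst u) (fst v)) \<bar>snd u - snd v\<bar>"

abbreviation cylinder_height :: "cone_point \<times> real \<Rightarrow> real" where
  "cylinder_height u \<equiv> snd (fst u)"

lemma cylinder_iff: "u \<in> cylinder D q \<longleftrightarrow> fst u \<in> D \<and> 0 \<le> snd u \<and> snd u \<le> q (fst u) + 1"
  unfolding cylinder_def by auto

lemma cylinder_dist_sym: "cylinder_dist n u v = cylinder_dist n v u"
  unfolding cylinder_dist_def by (metis abs_minus_commute cone_dist_sym)

text \<open>
  The cylinder is again metric, so that cones and cylinders fall under the same lemmas.
\<close>

lemma coarse_cylinder_metric:
  "coarse_cylinder q (metric_coarse D (cone_dist n)) = metric_coarse (cylinder D q) (cylinder_dist n)"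
proof -
  have "(P \<in> entourages (coarse_prod (metric_coarse D (cone_dist n)) rplus) \<and> P \<subseteq> cylinder D q \<times> cylinder D q)
    \<longleftrightarrow> P \<subseteq> cylinder D q \<times> cylinder D q \<and> (\<exists>R. \<forall>(x, y)\<in>P. cylinder_dist n x y < R)" for P
  proof safe
    assume "P \<in> entourages (coarse_prod (metric_coarse D (cone_dist n)) rplus)"
    then obtain M N R R' where *: "P \<subseteq> {((x, y), (x', y')) | x y x' y'. (x, x') \<in> M \<and> (y, y') \<in> N}"
      "\<forall>(x, y)\<in>M. cone_dist n x y < R" "\<forall>(x, y)\<in>N. \<bar>x - y\<bar> < R'"
      unfolding coarse_prod_def metric_coarse_def rplus_def by (auto simp: dist_real_def)
    have "\<forall>(x, y)\<in>P. cylinder_dist n x y < max R R'"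
    proof safe
      fix a b c d assume "((a, b), (c, d)) \<in> P"
      then have "(a, c) \<in> M" "(b, d) \<in> N" using *(1) by auto
      then show "cylinder_dist n (a, b) (c, d) < max R R'"
        using *(2,3) unfolding cylinder_dist_def by fastforce
    qed
    then show "\<exists>R. \<forall>(x, y)\<in>P. cylinder_dist n x y < R" by blast
  next
    fix R assume P: "P \<subseteq> cylinder D q \<times> cylinder D q" and R: "\<forall>(x, y)\<in>P. cylinder_dist n x y < R"
    let ?M = "{(fst u, fst v) | u v. (u, v) \<in> P}" and ?N = "{(snd u, snd v) | u v. (u, v) \<in> P}"
    have "?M \<in> entourages (metric_coarse D (cone_dist n))"
      using P R unfolding metric_coarse_def cylinder_def cylinder_dist_def
      by (fastforce intro!: exI[of _ R])
    moreover have "?N \<in> entourages rplus"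
      using P R unfolding metric_coarse_def cylinder_def cylinder_dist_def rplus_def
      by (fastforce simp: dist_real_def intro!: exI[of _ R])
    moreover have "P \<subseteq> {((x, y), (x', y')) | x y x' y'. (x, x') \<in> ?M \<and> (y, y') \<in> ?N}" by force
    ultimately show "P \<in> entourages (coarse_prod (metric_coarse D (cone_dist n)) rplus)"
      unfolding coarse_prod_def coarse.simps mem_Collect_eq
      by (intro bexI[of _ ?M] bexI[of _ ?N]) simp_all
  qed
  then show ?thesis
    unfolding coarse_cylinder_def coarse_subspace_def
    by (auto simp: metric_coarse_def cylinder_def)
qed

text \<open>
  The coarse maps from a cone to the half-line, in terms of inequalities (\<open>coarse_map_rplus_iff_tame\<close>).
\<close>

definition tame_height :: "nat \<Rightarrow> cone_point set \<Rightarrow> (cone_point \<Rightarrow> real) \<Rightarrow> bool" where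
  "tame_height n D q \<longleftrightarrow>
     (\<forall>z\<in>D. 0 \<le> q z) \<and>
     (\<forall>R. \<exists>R'. \<forall>z\<in>D. \<forall>w\<in>D. cone_dist n z w \<le> R \<longrightarrow> \<bar>q z - q w\<bar> \<le> R') \<and>
     (\<forall>R. \<exists>R'. \<forall>z\<in>D. q z \<le> R \<longrightarrow> snd z \<le> R')"

lemma rplus_entourage_iff:
  "M \<in> entourages rplus \<longleftrightarrow> M \<subseteq> {0..} \<times> {0..} \<and> (\<exists>R. \<forall>(x, y)\<in>M. \<bar>x - y\<bar> \<le> R)"
proof -
  have "(\<exists>R. \<forall>(x, y)\<in>M. \<bar>x - y\<bar> < R) \<longleftrightarrow> (\<exists>R. \<forall>(x, y)\<in>M. \<bar>x - y\<bar> \<le> R)"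
  proof
    assume "\<exists>R. \<forall>(x, y)\<in>M. \<bar>x - y\<bar> < R"
    then obtain R where "\<forall>(x, y)\<in>M. \<bar>x - y\<bar> < R" by blast
    then show "\<exists>R. \<forall>(x, y)\<in>M. \<bar>x - y\<bar> \<le> R" by (intro exI[of _ R]) auto
  next
    assume "\<exists>R. \<forall>(x, y)\<in>M. \<bar>x - y\<bar> \<le> R"
    then obtain R where "\<forall>(x, y)\<in>M. \<bar>x - y\<bar> \<le> R" by blast
    then show "\<exists>R. \<forall>(x, y)\<in>M. \<bar>x - y\<bar> < R" by (intro exI[of _ "R + 1"]) force
  qed
  then show ?thesis unfolding rplus_def metric_coarse_def dist_real_def by auto
qed

lemma coarse_space_rplus: "coarse_space rplus"
  unfolding coarse_space_def
proof (intro conjI ballI allI impI)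
  fix M N assume "M \<in> entourages rplus" "N \<in> entourages rplus"
  then obtain R1 R2 where *: "M \<subseteq> {0..} \<times> {0..}" "\<forall>(x, y)\<in>M. \<bar>x - y\<bar> \<le> R1"
    "N \<subseteq> {0..} \<times> {0..}" "\<forall>(x, y)\<in>N. \<bar>x - y\<bar> \<le> R2"
    unfolding rplus_entourage_iff by blast
  then have "\<forall>(x, y)\<in>M \<union> N. \<bar>x - y\<bar> \<le> max R1 R2" by fastforce
  then show "M \<union> N \<in> entourages rplus" using * unfolding rplus_entourage_iff by blast
  have "\<forall>(x, y)\<in>M O N. \<bar>x - y\<bar> \<le> R1 + R2" using * by fastforce
  then show "M O N \<in> entourages rplus" using * unfolding rplus_entourage_iff by blast
next
  fix M N assume "M \<in> entourages rplus" "N \<subseteq> M"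
  then show "N \<in> entourages rplus" unfolding rplus_entourage_iff by blast
next
  fix M assume "M \<in> entourages rplus"
  then obtain R where M: "M \<subseteq> {0..} \<times> {0..}" and R: "\<And>x y. (x, y) \<in> M \<Longrightarrow> \<bar>x - y\<bar> \<le> R"
    unfolding rplus_entourage_iff by blast
  have "\<forall>(x, y)\<in>M\<inverse>. \<bar>x - y\<bar> \<le> R" using R by (metis (no_types, lifting) abs_minus_commute case_prodI2 converseD)
  then show "M\<inverse> \<in> entourages rplus" using M unfolding rplus_entourage_iff by blast
next
  have "{(a, b)} \<in> entourages rplus" if "0 \<le> a" "0 \<le> b" for a b
    using that unfolding rplus_entourage_iff by auto
  then have "{0..} \<times> {0..} \<subseteq> \<Union> (entourages rplus)" by fast
  moreover have "\<Union> (entourages rplus) \<subseteq> {0..} \<times> {0..}" using rplus_entourage_iff by auto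
  ultimately show "\<Union> (entourages rplus) = carrier rplus \<times> carrier rplus"
    by (simp add: rplus_def metric_coarse_def)
next
  show "Id_on (carrier rplus) \<in> entourages rplus"
    unfolding rplus_entourage_iff by (auto simp: rplus_def metric_coarse_def)
qed

lemma height_gauge_rplus: "height_gauge {0..} dist (\<lambda>r. r :: real)"
  unfolding height_gauge_def by (auto simp: dist_real_def intro!: bexI[of _ 0])

lemma cone_dist_origin_bounded:
  assumes "D \<subseteq> cube_cone n"
  shows "\<exists>R'. \<forall>z\<in>D. snd z \<le> R \<longrightarrow> cone_dist n z (\<lambda>_. 0, 0) \<le> R'"
proof (intro exI ballI impI)
  fix z assume z: "z \<in> D" "snd z \<le> R"
  have "(real n + 1) * snd z \<le> (real n + 1) * R" using z by (intro mult_left_mono) auto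
  then show "cone_dist n z (\<lambda>_. 0, 0) \<le> (real n + 1) * R"
    using cone_dist_origin[of z n] assms z(1) by (meson order_trans subsetD)
qed

lemma height_gauge_cone:
  assumes "D \<subseteq> cube_cone n" "(\<lambda>_. 0, 0) \<in> D"
  shows "height_gauge D (cone_dist n) snd"
  unfolding height_gauge_def
proof (intro conjI ballI bexI[of _ "(\<lambda>_. 0, 0)"] allI)
  show "\<exists>R'. \<forall>z\<in>D. snd z \<le> R \<longrightarrow> cone_dist n z (\<lambda>_. 0, 0) \<le> R'" for R
    by (rule cone_dist_origin_bounded[OF assms(1)])
next
  fix z w :: cone_point
  show "snd z \<le> snd w + cone_dist n z w" using height_le_cone_dist[of z w n] by linarith
qed (fact assms(2))

lemma tame_bounded:
  assumes "D \<subseteq> cube_cone n" "(\<lambda>_. 0, 0) \<in> D" "tame_height n D q"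
  shows "\<exists>R'. \<forall>z\<in>D. snd z \<le> R \<longrightarrow> q z \<le> R'"
proof -
  obtain R1 where R1: "\<forall>z\<in>D. snd z \<le> R \<longrightarrow> cone_dist n z (\<lambda>_. 0, 0) \<le> R1"
    using cone_dist_origin_bounded[OF assms(1)] by blast
  obtain R2 where "\<forall>z\<in>D. \<forall>w\<in>D. cone_dist n z w \<le> R1 \<longrightarrow> \<bar>q z - q w\<bar> \<le> R2"
    using assms(3) unfolding tame_height_def by blast
  then have "\<forall>z\<in>D. snd z \<le> R \<longrightarrow> q z \<le> q (\<lambda>_. 0, 0) + R2"
    using R1 assms(2) by fastforce
  then show ?thesis by blast
qed

lemma height_gauge_cylinder:
  assumes "D \<subseteq> cube_cone n" "(\<lambda>_. 0, 0) \<in> D" "tame_height n D q"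
  shows "height_gauge (cylinder D q) (cylinder_dist n) cylinder_height"
  unfolding height_gauge_def
proof (intro conjI ballI bexI[of _ "((\<lambda>_. 0, 0), 0)"] allI)
  fix R
  obtain R1 where R1: "\<forall>z\<in>D. snd z \<le> R \<longrightarrow> cone_dist n z (\<lambda>_. 0, 0) \<le> R1"
    using cone_dist_origin_bounded[OF assms(1)] by blast
  obtain R2 where R2: "\<forall>z\<in>D. snd z \<le> R \<longrightarrow> q z \<le> R2" using tame_bounded[OF assms] by blast
  have "\<forall>u\<in>cylinder D q. cylinder_height u \<le> R \<longrightarrow> cylinder_dist n u ((\<lambda>_. 0, 0), 0) \<le> max R1 (R2 + 1)"
  proof safe
    fix z t assume u: "(z, t) \<in> cylinder D q" "cylinder_height (z, t) \<le> R"
    then have "z \<in> D" "0 \<le> t" "t \<le> q z + 1" unfolding cylinder_iff by auto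
    moreover have "q z \<le> R2" "cone_dist n z (\<lambda>_. 0, 0) \<le> R1" using R1 R2 u(2) \<open>z \<in> D\<close> by auto
    ultimately show "cylinder_dist n (z, t) ((\<lambda>_. 0, 0), 0) \<le> max R1 (R2 + 1)"
      unfolding cylinder_dist_def by auto
  qed
  then show "\<exists>R'. \<forall>u\<in>cylinder D q. cylinder_height u \<le> R \<longrightarrow> cylinder_dist n u ((\<lambda>_. 0, 0), 0) \<le> R'" by blast
next
  fix u v :: "cone_point \<times> real"
  show "cylinder_height u \<le> cylinder_height v + cylinder_dist n u v"
    using height_le_cone_dist[of "fst u" "fst v" n] unfolding cylinder_dist_def by linarith
next
  show "((\<lambda>_. 0, 0), 0) \<in> cylinder D q"
    using assms(2,3) unfolding cylinder_iff tame_height_def by auto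
qed

lemma coarse_map_rplus_iff_tame:
  assumes "D \<subseteq> cube_cone n" "(\<lambda>_. 0, 0) \<in> D"
  shows "coarse_map (metric_coarse D (cone_dist n)) rplus q \<longleftrightarrow> tame_height n D q"
proof -
  have bounded: "coarsely_bounded rplus B \<longleftrightarrow> B \<subseteq> {0..} \<and> (\<exists>R. \<forall>z\<in>B. z \<le> R)" for B
    using coarsely_bounded_metric[OF height_gauge_rplus] unfolding rplus_def by auto
  have car: "carrier rplus = {0..}" unfolding rplus_def metric_coarse_def by simp
  show ?thesis
    unfolding coarse_map_iff_height_coarse[OF coarse_space_rplus height_gauge_cone[OF assms]]
  proof
    assume h: "height_coarse D (cone_dist n) snd rplus q"
    have nonneg: "\<forall>z\<in>D. 0 \<le> q z" using h unfolding height_coarse_def car by auto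
    moreover have "\<exists>R'. \<forall>z\<in>D. \<forall>w\<in>D. cone_dist n z w \<le> R \<longrightarrow> \<bar>q z - q w\<bar> \<le> R'" for R
    proof -
      have "{(q x, q y) | x y. x \<in> D \<and> y \<in> D \<and> cone_dist n x y \<le> R} \<in> entourages rplus"
        using h unfolding height_coarse_def by blast
      then obtain R' where "\<forall>(x, y)\<in>{(q x, q y) | x y. x \<in> D \<and> y \<in> D \<and> cone_dist n x y \<le> R}. \<bar>x - y\<bar> \<le> R'"
        unfolding rplus_entourage_iff by blast
      then show ?thesis by blast
    qed
    moreover have "\<exists>R'. \<forall>z\<in>D. q z \<le> R \<longrightarrow> snd z \<le> R'" for R
    proof -
      have "coarsely_bounded rplus {0..R}" unfolding bounded by auto
      then obtain R' where "\<forall>x\<in>D. q x \<in> {0..R} \<longrightarrow> snd x \<le> R'"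
        using h unfolding height_coarse_def by blast
      then show ?thesis using nonneg by auto
    qed
    ultimately show "tame_height n D q" unfolding tame_height_def by blast
  next
    assume t: "tame_height n D q"
    have nonneg: "\<forall>z\<in>D. 0 \<le> q z" using t unfolding tame_height_def by blast
    have "{(q x, q y) | x y. x \<in> D \<and> y \<in> D \<and> cone_dist n x y \<le> R} \<in> entourages rplus" for R
    proof -
      obtain R' where "\<forall>z\<in>D. \<forall>w\<in>D. cone_dist n z w \<le> R \<longrightarrow> \<bar>q z - q w\<bar> \<le> R'"
        using t unfolding tame_height_def by blast
      then show ?thesis using nonneg unfolding rplus_entourage_iff by (auto intro!: exI[of _ R'])
    qed
    moreover have "\<exists>R. \<forall>x\<in>D. q x \<in> B \<longrightarrow> snd x \<le> R" if "coarsely_bounded rplus B" for B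
      using that t unfolding bounded tame_height_def by meson
    ultimately show "height_coarse D (cone_dist n) snd rplus q"
      unfolding height_coarse_def car using nonneg by auto
  qed
qed

lemma tame_heightE:
  assumes "tame_height n D q"
  obtains R' where "0 \<le> R'" "\<And>z w. z \<in> D \<Longrightarrow> w \<in> D \<Longrightarrow> cone_dist n z w \<le> R \<Longrightarrow> \<bar>q z - q w\<bar> \<le> R'"
proof -
  obtain R' where "\<forall>z\<in>D. \<forall>w\<in>D. cone_dist n z w \<le> R \<longrightarrow> \<bar>q z - q w\<bar> \<le> R'"
    using assms unfolding tame_height_def by blast
  then show thesis by (intro that[of "max R' 0"]) fastforce+
qed

lemma tame_height_nonneg: "tame_height n D q \<Longrightarrow> z \<in> D \<Longrightarrow> 0 \<le> q z"
  unfolding tame_height_def by blast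

lemma tame_height_subset: "tame_height n D q \<Longrightarrow> D' \<subseteq> D \<Longrightarrow> tame_height n D' q"
  unfolding tame_height_def by (meson in_mono)

lemma tame_height_snd:
  assumes "D \<subseteq> cube_cone n"
  shows "tame_height n D snd"
  unfolding tame_height_def
proof (intro conjI allI ballI)
  fix z assume "z \<in> D" then show "0 \<le> snd z" using assms cube_cone_iff by blast
next
  fix R
  show "\<exists>R'. \<forall>z\<in>D. \<forall>w\<in>D. cone_dist n z w \<le> R \<longrightarrow> \<bar>snd z - snd w\<bar> \<le> R'"
    using height_le_cone_dist order_trans by blast
qed auto

lemma tame_height_add:
  assumes "tame_height n D q" "tame_height n D q'" "0 \<le> c"
  shows "tame_height n D (\<lambda>z. q z + q' z + c)"
  unfolding tame_height_def
proof (intro conjI allI ballI)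
  fix z assume "z \<in> D" then show "0 \<le> q z + q' z + c"
    using tame_height_nonneg[OF assms(1)] tame_height_nonneg[OF assms(2)] assms(3) by simp
next
  fix R
  obtain R1 where R1: "\<And>z w. z \<in> D \<Longrightarrow> w \<in> D \<Longrightarrow> cone_dist n z w \<le> R \<Longrightarrow> \<bar>q z - q w\<bar> \<le> R1"
    using tame_heightE[OF assms(1)] by metis
  obtain R2 where R2: "\<And>z w. z \<in> D \<Longrightarrow> w \<in> D \<Longrightarrow> cone_dist n z w \<le> R \<Longrightarrow> \<bar>q' z - q' w\<bar> \<le> R2"
    using tame_heightE[OF assms(2)] by metis
  show "\<exists>R'. \<forall>z\<in>D. \<forall>w\<in>D. cone_dist n z w \<le> R \<longrightarrow> \<bar>q z + q' z + c - (q w + q' w + c)\<bar> \<le> R'"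
    using R1 R2 by (intro exI[of _ "R1 + R2"]) (smt (verit))
next
  fix R
  obtain R' where R': "\<forall>z\<in>D. q z \<le> R \<longrightarrow> snd z \<le> R'" using assms(1) unfolding tame_height_def by blast
  then show "\<exists>R'. \<forall>z\<in>D. q z + q' z + c \<le> R \<longrightarrow> snd z \<le> R'"
    using assms tame_height_nonneg by (smt (verit, best))
qed

section \<open>Reparametrizing one coordinate\<close>

text \<open>
  A self-map \<open>s _ h\<close> of each interval \<open>[0, h]\<close>, jointly Lipschitz in the coordinate and the height; the factor
  2 leaves room for concatenations of two maps. Both
  ends may go to the same end: this is what lets a path followed by its reverse be pulled back from the path.
\<close>

definition reparametrization :: "(real \<Rightarrow> real \<Rightarrow> real) \<Rightarrow> bool" where
  "reparametrization s \<longleftrightarrow>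
     (\<forall>x h. 0 \<le> x \<longrightarrow> x \<le> h \<longrightarrow> 0 \<le> s x h \<and> s x h \<le> h) \<and>
     (\<forall>h\<ge>0. s 0 h \<in> {0, h} \<and> s h h \<in> {0, h}) \<and>
     (\<forall>x h y g. \<bar>s x h - s y g\<bar> \<le> 2 * \<bar>x - y\<bar> + \<bar>h - g\<bar>)"

definition reparam :: "nat \<Rightarrow> (real \<Rightarrow> real \<Rightarrow> real) \<Rightarrow> cone_point \<Rightarrow> cone_point" where
  "reparam j s z = set_coord j (s (fst z j) (snd z)) z"

lemma snd_reparam [simp]: "snd (reparam j s z) = snd z"
  unfolding reparam_def by simp

lemma reparam_dist:
  assumes "reparametrization s" "j < n"
  shows "cone_dist n (reparam j s z) (reparam j s w) \<le> 4 * cone_dist n z w"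
proof -
  have *: "cone_dist n (reparam j s z) (reparam j s w)
      \<le> cone_dist n z w + \<bar>s (fst z j) (snd z) - s (fst w j) (snd w)\<bar>"
    unfolding reparam_def by (rule cone_dist_set_coord)
  have "\<bar>s (fst z j) (snd z) - s (fst w j) (snd w)\<bar> \<le> 2 * \<bar>fst z j - fst w j\<bar> + \<bar>snd z - snd w\<bar>"
    using assms(1) unfolding reparametrization_def by blast
  then show ?thesis
    using * coord_le_cone_dist[OF assms(2), of z w] height_le_cone_dist[of z w n] by (smt (verit))
qed

abbreviation lower_half :: "nat \<Rightarrow> cone_point \<Rightarrow> cone_point" where
  "lower_half j \<equiv> reparam j (\<lambda>x h. min (2 * x) h)"
abbreviation upper_half :: "nat \<Rightarrow> cone_point \<Rightarrow> cone_point" where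
  "upper_half j \<equiv> reparam j (\<lambda>x h. max (2 * x - h) 0)"

lemma reparametrizationI:
  assumes "\<And>x h. 0 \<le> x \<Longrightarrow> x \<le> h \<Longrightarrow> 0 \<le> s x h" "\<And>x h. 0 \<le> x \<Longrightarrow> x \<le> h \<Longrightarrow> s x h \<le> h"
    and "\<And>h. 0 \<le> h \<Longrightarrow> s 0 h \<in> {0, h}" "\<And>h. 0 \<le> h \<Longrightarrow> s h h \<in> {0, h}"
    and "\<And>x h y g. s x h - s y g \<le> 2 * \<bar>x - y\<bar> + \<bar>h - g\<bar>"
  shows "reparametrization s"
proof -
  have "\<bar>s x h - s y g\<bar> \<le> 2 * \<bar>x - y\<bar> + \<bar>h - g\<bar>" for x h y g
    using assms(5)[of x h y g] assms(5)[of y g x h]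
    by (simp add: abs_le_iff abs_minus_commute)
  then show ?thesis unfolding reparametrization_def using assms(1-4) by blast
qed

lemma reparametrization_halves:
  "reparametrization (\<lambda>x h. min (2 * x) h)" "reparametrization (\<lambda>x h. max (2 * x - h) 0)"
  by (rule reparametrizationI; (simp; fail | linarith | smt (verit)))+

text \<open>
  The clamped maps \<open>lower_half\<close> and \<open>upper_half\<close> are defined on the whole cone and preserve it, unlike
  the plain formulas \<open>2 x\<close> and \<open>2 x - h\<close>, with which they agree on the half where they are used.
\<close>

definition coord_concat :: "nat \<Rightarrow> (cone_point \<Rightarrow> 'a) \<Rightarrow> (cone_point \<Rightarrow> 'a) \<Rightarrow> cone_point \<Rightarrow> 'a" where
  "coord_concat j F G z = (if fst z j \<le> snd z / 2 then F (lower_half j z) else G (upper_half j z))"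

lemma cone_concat_eq: "cone_concat F G = coord_concat 0 F G"
proof
  fix z :: cone_point
  have "min (2 * fst z 0) (snd z) = 2 * fst z 0" if "fst z 0 \<le> snd z / 2" using that by linarith
  moreover have "max (2 * fst z 0 - snd z) 0 = 2 * fst z 0 - snd z" if "\<not> fst z 0 \<le> snd z / 2"
    using that by linarith
  ultimately show "cone_concat F G z = coord_concat 0 F G z"
    unfolding cone_concat_def coord_concat_def reparam_def set_coord_def by (cases z) auto
qed

text \<open>
  A height for the concatenation of homotopies of heights \<open>q\<close> and \<open>q'\<close>. At each point it is at least
  the height of whichever homotopy is used there.
\<close>

definition concat_height :: "nat \<Rightarrow> (cone_point \<Rightarrow> real) \<Rightarrow> (cone_point \<Rightarrow> real) \<Rightarrow> cone_point \<Rightarrow> real" where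
  "concat_height j q q' z = q (lower_half j z) + q' (upper_half j z)"

text \<open>
  The point reached at time \<open>t\<close> when moving from \<open>s0 x h\<close> towards \<open>s1 x h\<close> at unit speed and resting
  there. Built from \<open>min\<close>, \<open>max\<close> and sums, it is visibly Lipschitz in all variables, whereas linear
  interpolation would involve the quotient \<open>t / (h + 1)\<close>.
\<close>

definition slide :: "(real \<Rightarrow> real \<Rightarrow> real) \<Rightarrow> (real \<Rightarrow> real \<Rightarrow> real) \<Rightarrow> real \<Rightarrow> real \<Rightarrow> real \<Rightarrow> real" where
  "slide s0 s1 t x h = max (min (s1 x h) (s0 x h + t)) (s0 x h - t)"

lemma reparam_reparam:
  "reparam j s (reparam j s' z) = reparam j (\<lambda>x h. s (s' x h) h) z"
  unfolding reparam_def by simp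

lemma reparam_commute: "i \<noteq> j \<Longrightarrow> reparam i s (reparam j s' z) = reparam j s' (reparam i s z)"
  unfolding reparam_def by (simp add: set_coord_commute)

lemma fst_reparam: "fst (reparam j s z) j = s (fst z j) (snd z)"
  "i \<noteq> j \<Longrightarrow> fst (reparam j s z) i = fst z i"
  unfolding reparam_def by simp_all

lemma reparam_cong: "s (fst z j) (snd z) = s' (fst z j) (snd z) \<Longrightarrow> reparam j s z = reparam j s' z"
  unfolding reparam_def by simp

lemma reparam_ident: "reparam j (\<lambda>x h. x) z = z"
  unfolding reparam_def by simp

text \<open>
  The convex piecewise linear map of \<open>[0, h]\<close> with slopes 1/2, 1, 2 that sends the breakpoints
  \<open>h/2\<close>, \<open>3h/4\<close> of \<open>F * (G * H)\<close> to the breakpoints \<open>h/4\<close>, \<open>h/2\<close> of \<open>(F * G) * H\<close>.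
\<close>

definition assoc_shift :: "real \<Rightarrow> real \<Rightarrow> real" where
  "assoc_shift x h = max (x / 2) (max (x - h / 4) (2 * x - h))"

lemma reparametrization_ident: "reparametrization (\<lambda>x h. x)"
  and reparametrization_top: "reparametrization (\<lambda>x h. h)"
  and reparametrization_flip: "reparametrization (\<lambda>x h. h - x)"
  and reparametrization_fold: "reparametrization (\<lambda>x h. \<bar>2 * x - h\<bar>)"
  by (rule reparametrizationI; (simp; fail | linarith | smt (verit)))+

lemma reparametrization_assoc: "reparametrization assoc_shift"
proof (rule reparametrizationI)
  fix x h y g :: real
  let ?d = "2 * \<bar>x - y\<bar> + \<bar>h - g\<bar>"
  have "x / 2 \<le> y / 2 + ?d" "x - h / 4 \<le> y - g / 4 + ?d" "2 * x - h \<le> 2 * y - g + ?d"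
    by argo+
  then show "assoc_shift x h - assoc_shift y g \<le> ?d" unfolding assoc_shift_def by linarith
qed (auto simp: assoc_shift_def)

lemma slide_start: "reparam j (slide s0 s1 0) z = reparam j s0 z"
  by (rule reparam_cong) (simp add: slide_def)

lemma coord_concat_assoc:
  assumes "0 \<le> fst z j" "fst z j \<le> snd z"
  shows "coord_concat j (coord_concat j F G) H (reparam j assoc_shift z)
    = coord_concat j F (coord_concat j G H) z"
proof -
  let ?x = "fst z j" and ?h = "snd z"
  consider "?x \<le> ?h / 2" | "?h / 2 < ?x" "?x \<le> 3 * ?h / 4" | "3 * ?h / 4 < ?x" by linarith
  then show ?thesis
  proof cases
    case 1
    then have "assoc_shift ?x ?h = ?x / 2" using assms unfolding assoc_shift_def by linarith
    then show ?thesis using 1 assms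
      by (simp add: coord_concat_def reparam_reparam fst_reparam) (auto intro!: arg_cong[of _ _ F] reparam_cong)
  next
    case 2
    then have "assoc_shift ?x ?h = ?x - ?h / 4" using assms unfolding assoc_shift_def by linarith
    then show ?thesis using 2 assms
      by (simp add: coord_concat_def reparam_reparam fst_reparam) (auto intro!: arg_cong[of _ _ G] reparam_cong)
  next
    case 3
    then have "assoc_shift ?x ?h = 2 * ?x - ?h" using assms unfolding assoc_shift_def by linarith
    then show ?thesis using 3 assms
      by (simp add: coord_concat_def reparam_reparam fst_reparam) (auto intro!: arg_cong[of _ _ H] reparam_cong)
  qed
qed

lemma coord_concat_interchange:
  assumes "i \<noteq> j"
  shows "coord_concat i (coord_concat j F G) (coord_concat j F' G') z
    = coord_concat j (coord_concat i F F') (coord_concat i G G') z"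
  using assms unfolding coord_concat_def
  by (auto simp: fst_reparam reparam_commute[OF assms])

section \<open>Coarse maps and homotopies on a cone with a based part\<close>

text \<open>
  The setting for one component of a map of pairs: \<open>D\<close> is the domain, \<open>b\<close> the basepoint path of the
  target, \<open>P\<close> the part of \<open>D\<close> where maps are prescribed by \<open>b\<close>, and \<open>J\<close> the coordinates along which
  concatenation is allowed. The stability assumptions make \<open>D\<close> and \<open>P\<close> invariant under
  reparametrizations of these coordinates. The last assumption is what makes concatenation possible:
  every point of a face \<open>x\<^sub>j = 0\<close> or \<open>x\<^sub>j = h\<close> with \<open>j \<in> J\<close> is within distance 1 of \<open>P\<close>, and \<open>R\<close> is the
  thickness of a neighbourhood of the face.
\<close>

locale based_domain =
  fixes n :: nat and P D :: "cone_point set" and J :: "nat set"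
    and Y :: "'a coarse" and b :: "real \<Rightarrow> 'a"
  assumes Y: "coarse_space Y"
    and base: "coarse_map rplus Y b"
    and D_cube: "D \<subseteq> cube_cone n"
    and P_D: "P \<subseteq> D"
    and origin: "(\<lambda>_. 0, 0) \<in> D"
    and J_less: "j \<in> J \<Longrightarrow> j < n"
    and D_stable: "\<lbrakk>z \<in> D; j \<in> J; 0 \<le> r; r \<le> snd z; fst z j \<in> {0, snd z} \<longrightarrow> r \<in> {0, snd z}\<rbrakk>
      \<Longrightarrow> set_coord j r z \<in> D"
    and P_stable: "\<lbrakk>z \<in> P; j \<in> J; 0 \<le> r; r \<le> snd z; fst z j \<in> {0, snd z} \<longrightarrow> r \<in> {0, snd z}\<rbrakk>
      \<Longrightarrow> set_coord j r z \<in> P"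
    and P_near: "\<lbrakk>z \<in> D; j \<in> J; 0 \<le> R; fst z j \<le> R \<or> snd z - fst z j \<le> R\<rbrakk>
      \<Longrightarrow> \<exists>w\<in>P. cone_dist n z w \<le> R + 1"
begin

abbreviation "cone_coarse f \<equiv> height_coarse D (cone_dist n) snd Y f"
abbreviation "cylinder_coarse q H \<equiv>
  height_coarse (cylinder D q) (cylinder_dist n) cylinder_height Y H"

lemma D_coord: "z \<in> D \<Longrightarrow> j \<in> J \<Longrightarrow> 0 \<le> fst z j \<and> fst z j \<le> snd z"
  using D_cube J_less cube_cone_iff by blast

lemma D_height: "z \<in> D \<Longrightarrow> 0 \<le> snd z"
  using D_cube cube_cone_iff by blast

lemma reparam_D: "z \<in> D \<Longrightarrow> j \<in> J \<Longrightarrow> reparametrization s \<Longrightarrow> reparam j s z \<in> D"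
  unfolding reparam_def using D_coord[of z j] D_height[of z]
  by (intro D_stable) (auto simp: reparametrization_def)

lemma reparam_P: "z \<in> P \<Longrightarrow> j \<in> J \<Longrightarrow> reparametrization s \<Longrightarrow> reparam j s z \<in> P"
  unfolding reparam_def using D_coord[of z j] D_height[of z] P_D
  by (intro P_stable) (auto simp: reparametrization_def)

lemma tame_height_reparam:
  assumes "tame_height n D q" "j \<in> J" "reparametrization s"
  shows "tame_height n D (\<lambda>z. q (reparam j s z))"
  unfolding tame_height_def
proof (intro conjI allI ballI)
  fix z assume "z \<in> D" then show "0 \<le> q (reparam j s z)"
    using assms tame_height_nonneg reparam_D by blast
next
  fix R
  obtain R' where R': "\<And>z w. z \<in> D \<Longrightarrow> w \<in> D \<Longrightarrow> cone_dist n z w \<le> 4 * R \<Longrightarrow> \<bar>q z - q w\<bar> \<le> R'"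
    using tame_heightE[OF assms(1)] by metis
  have "\<bar>q (reparam j s z) - q (reparam j s w)\<bar> \<le> R'"
    if "z \<in> D" "w \<in> D" "cone_dist n z w \<le> R" for z w
    using R'[of "reparam j s z" "reparam j s w"] reparam_D[OF _ assms(2,3)] that
      reparam_dist[OF assms(3) J_less[OF assms(2)], of z w] by auto
  then show "\<exists>R'. \<forall>z\<in>D. \<forall>w\<in>D. cone_dist n z w \<le> R \<longrightarrow> \<bar>q (reparam j s z) - q (reparam j s w)\<bar> \<le> R'"
    by blast
next
  fix R
  obtain R' where R': "\<forall>z\<in>D. q z \<le> R \<longrightarrow> snd z \<le> R'" using assms(1) unfolding tame_height_def by blast
  then show "\<exists>R'. \<forall>z\<in>D. q (reparam j s z) \<le> R \<longrightarrow> snd z \<le> R'"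
    using reparam_D[OF _ assms(2,3)] by fastforce
qed

lemma tame_height_concat:
  assumes "tame_height n D q" "tame_height n D q'" "j \<in> J"
  shows "tame_height n D (concat_height j q q')"
  using tame_height_add[OF tame_height_reparam[OF assms(1,3) reparametrization_halves(1)]
      tame_height_reparam[OF assms(2,3) reparametrization_halves(2)], of 0]
  by (simp add: concat_height_def[abs_def])

lemma base_height: "height_coarse {0..} dist (\<lambda>r. r) Y b"
  using base coarse_map_iff_height_coarse[OF Y height_gauge_rplus] unfolding rplus_def by blast

lemma cone_coarse_base: "cone_coarse (\<lambda>z. b (snd z))"
proof (rule height_coarse_compose[OF Y base_height])
  show "\<exists>R'. \<forall>z\<in>D. \<forall>w\<in>D. cone_dist n z w \<le> R \<longrightarrow> dist (snd z) (snd w) \<le> R'" for R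
    unfolding dist_real_def using height_le_cone_dist order_trans by blast
qed (auto dest: D_height)

lemma cylinder_coarse_const:
  assumes "cone_coarse f"
  shows "cylinder_coarse q (\<lambda>u. f (fst u))"
proof (rule height_coarse_compose[OF Y assms])
  show "\<exists>R'. \<forall>x\<in>cylinder D q. \<forall>y\<in>cylinder D q.
      cylinder_dist n x y \<le> R \<longrightarrow> cone_dist n (fst x) (fst y) \<le> R'" for R
    unfolding cylinder_dist_def by auto
qed (auto simp: cylinder_iff)

lemma cone_coarse_slice:
  assumes "tame_height n D q" "cylinder_coarse q H"
  shows "cone_coarse (\<lambda>z. H (z, 0))"
proof (rule height_coarse_compose[OF Y assms(2)])
  show "\<exists>R'. \<forall>z\<in>D. \<forall>w\<in>D. cone_dist n z w \<le> R \<longrightarrow> cylinder_dist n (z, 0) (w, 0) \<le> R'" for R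
    unfolding cylinder_dist_def by (auto simp: cone_dist_nonneg)
qed (use tame_height_nonneg[OF assms(1)] in \<open>auto simp: cylinder_iff add_nonneg_nonneg\<close>)

text \<open>
  The map \<open>u \<mapsto> (\<alpha> u, \<tau> u)\<close> has to land in the target cylinder only on the piece \<open>Q\<close>, because
  the second halves of glued homotopies make sense only there.
\<close>

lemma cylinder_coarse_compose:
  assumes H: "cylinder_coarse q H"
    and mem: "\<And>u. u \<in> cylinder D q' \<Longrightarrow> Q u \<Longrightarrow> (\<alpha> u, \<tau> u) \<in> cylinder D q"
    and \<alpha>: "\<And>R. \<exists>R'. \<forall>u\<in>cylinder D q'. \<forall>v\<in>cylinder D q'. cylinder_dist n u v \<le> R \<longrightarrow> cone_dist n (\<alpha> u) (\<alpha> v) \<le> R'"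
    and \<tau>: "\<And>R. \<exists>R'. \<forall>u\<in>cylinder D q'. \<forall>v\<in>cylinder D q'. cylinder_dist n u v \<le> R \<longrightarrow> \<bar>\<tau> u - \<tau> v\<bar> \<le> R'"
    and height: "\<And>u. snd (\<alpha> u) = cylinder_height u"
  shows "height_coarse {u \<in> cylinder D q'. Q u} (cylinder_dist n) cylinder_height Y (\<lambda>u. H (\<alpha> u, \<tau> u))"
proof (rule height_coarse_compose[OF Y H])
  fix R
  obtain R1 where R1: "\<forall>u\<in>cylinder D q'. \<forall>v\<in>cylinder D q'. cylinder_dist n u v \<le> R \<longrightarrow> cone_dist n (\<alpha> u) (\<alpha> v) \<le> R1"
    using \<alpha> by blast
  obtain R2 where R2: "\<forall>u\<in>cylinder D q'. \<forall>v\<in>cylinder D q'. cylinder_dist n u v \<le> R \<longrightarrow> \<bar>\<tau> u - \<tau> v\<bar> \<le> R2"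
    using \<tau> by blast
  show "\<exists>R'. \<forall>u\<in>{u \<in> cylinder D q'. Q u}. \<forall>v\<in>{u \<in> cylinder D q'. Q u}.
      cylinder_dist n u v \<le> R \<longrightarrow> cylinder_dist n (\<alpha> u, \<tau> u) (\<alpha> v, \<tau> v) \<le> R'"
    using R1 R2 by (intro exI[of _ "max R1 R2"]) (force simp: cylinder_dist_def[of n "(_, _)"])
qed (use mem height in auto)

lemma cylinder_distD:
  "cylinder_dist n u v \<le> R \<Longrightarrow> cone_dist n (fst u) (fst v) \<le> R \<and> \<bar>snd u - snd v\<bar> \<le> R"
  unfolding cylinder_dist_def by auto

lemma cylinder_coarse_reverse:
  assumes q: "tame_height n D q" and H: "cylinder_coarse q H"
  shows "cylinder_coarse q (\<lambda>u. H (fst u, q (fst u) + 1 - snd u))"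
proof -
  have "height_coarse {u \<in> cylinder D q. True} (cylinder_dist n) cylinder_height Y
      (\<lambda>u. H (fst u, q (fst u) + 1 - snd u))"
  proof (rule cylinder_coarse_compose[OF H])
    fix R
    obtain R' where R': "\<And>z w. z \<in> D \<Longrightarrow> w \<in> D \<Longrightarrow> cone_dist n z w \<le> R \<Longrightarrow> \<bar>q z - q w\<bar> \<le> R'"
      using tame_heightE[OF q] by metis
    have "\<bar>q (fst u) + 1 - snd u - (q (fst v) + 1 - snd v)\<bar> \<le> R + R'"
      if "u \<in> cylinder D q" "v \<in> cylinder D q" "cylinder_dist n u v \<le> R" for u v
      using R'[of "fst u" "fst v"] cylinder_distD[OF that(3)] that(1,2) unfolding cylinder_iff by linarith
    then show "\<exists>R'. \<forall>u\<in>cylinder D q. \<forall>v\<in>cylinder D q. cylinder_dist n u v \<le> R \<longrightarrow>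
        \<bar>q (fst u) + 1 - snd u - (q (fst v) + 1 - snd v)\<bar> \<le> R'" by blast
  next
    show "\<exists>R'. \<forall>u\<in>cylinder D q. \<forall>v\<in>cylinder D q. cylinder_dist n u v \<le> R \<longrightarrow> cone_dist n (fst u) (fst v) \<le> R'" for R
      using cylinder_distD by blast
  qed (auto simp: cylinder_iff)
  then show ?thesis by simp
qed

lemma cylinder_coarse_ctl:
  "cylinder_coarse q H \<Longrightarrow>
    {(H u, H v) | u v. u \<in> cylinder D q \<and> v \<in> cylinder D q \<and> cylinder_dist n u v \<le> R} \<in> entourages Y"
  unfolding height_coarse_def by blast

text \<open>
  Near the seam \<open>t = q z + 1\<close> both homotopies are close to their common end \<open>H (z, q z + 1)\<close>,
  since \<open>q\<close> changes by a bounded amount between points at bounded distance.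
\<close>

lemma cylinder_coarse_join:
  assumes q: "tame_height n D q" and q': "tame_height n D q'"
    and H: "cylinder_coarse q H" and H': "cylinder_coarse q' H'"
    and eq: "\<And>z. z \<in> D \<Longrightarrow> H (z, q z + 1) = H' (z, 0)"
  shows "cylinder_coarse (\<lambda>z. q z + q' z + 1)
    (\<lambda>u. if snd u \<le> q (fst u) + 1 then H u else H' (fst u, snd u - q (fst u) - 1))"
proof -
  let ?q = "\<lambda>z. q z + q' z + 1"
  let ?f = "\<lambda>u. H (fst u, min (snd u) (q (fst u) + 1))"
  let ?g = "\<lambda>u. H' (fst u, snd u - q (fst u) - 1)"
  let ?c = "\<lambda>u. H (fst u, q (fst u) + 1)"
  let ?Q = "\<lambda>u. snd u \<le> q (fst u) + 1"
  have fst_ctl: "\<exists>R'. \<forall>u\<in>cylinder D ?q. \<forall>v\<in>cylinder D ?q. cylinder_dist n u v \<le> R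
      \<longrightarrow> cone_dist n (fst u) (fst v) \<le> R'" for R
    using cylinder_distD by blast
  have mono: "\<exists>R'. \<forall>u\<in>cylinder D ?q. \<forall>v\<in>cylinder D ?q. cylinder_dist n u v \<le> R
      \<longrightarrow> \<bar>\<tau> (snd u) (q (fst u)) - \<tau> (snd v) (q (fst v))\<bar> \<le> R'"
    if \<tau>: "\<And>a b c d. \<bar>\<tau> a b - \<tau> c d\<bar> \<le> \<bar>a - c\<bar> + \<bar>b - d\<bar>" for R and \<tau> :: "real \<Rightarrow> real \<Rightarrow> real"
  proof -
    obtain R' where R': "\<And>z w. z \<in> D \<Longrightarrow> w \<in> D \<Longrightarrow> cone_dist n z w \<le> R \<Longrightarrow> \<bar>q z - q w\<bar> \<le> R'"
      using tame_heightE[OF q] by metis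
    have "\<bar>\<tau> (snd u) (q (fst u)) - \<tau> (snd v) (q (fst v))\<bar> \<le> R + R'"
      if "u \<in> cylinder D ?q" "v \<in> cylinder D ?q" "cylinder_dist n u v \<le> R" for u v
      using R'[of "fst u" "fst v"] cylinder_distD[OF that(3)] that(1,2)
        \<tau>[of "snd u" "q (fst u)" "snd v" "q (fst v)"] unfolding cylinder_iff by linarith
    then show ?thesis by blast
  qed
  have "height_coarse {u \<in> cylinder D ?q. True} (cylinder_dist n) cylinder_height Y ?f"
  proof (rule cylinder_coarse_compose[OF H _ fst_ctl mono[of "\<lambda>a b. min a (b + 1)"]])
    show "(fst u, min (snd u) (q (fst u) + 1)) \<in> cylinder D q" if "u \<in> cylinder D ?q" for u
      using that tame_height_nonneg[OF q, of "fst u"] unfolding cylinder_iff by auto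
  qed auto
  then have f: "cylinder_coarse ?q ?f" by simp
  have "height_coarse {u \<in> cylinder D ?q. True} (cylinder_dist n) cylinder_height Y ?c"
  proof (rule cylinder_coarse_compose[OF H _ fst_ctl mono[of "\<lambda>a b. b + 1"]])
    show "(fst u, q (fst u) + 1) \<in> cylinder D q" if "u \<in> cylinder D ?q" for u
      using that tame_height_nonneg[OF q, of "fst u"] unfolding cylinder_iff by auto
  qed auto
  then have c: "cylinder_coarse ?q ?c" by simp
  have g: "height_coarse {u \<in> cylinder D ?q. \<not> ?Q u} (cylinder_dist n) cylinder_height Y ?g"
  proof (rule cylinder_coarse_compose[OF H' _ fst_ctl mono[of "\<lambda>a b. a - b - 1"]])
    show "(fst u, snd u - q (fst u) - 1) \<in> cylinder D q'" if "u \<in> cylinder D ?q" "\<not> ?Q u" for u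
      using that unfolding cylinder_iff by auto
  qed auto
  have seam: "\<bar>snd u - (q (fst u) + 1)\<bar> \<le> R + R'" "\<bar>snd v - (q (fst v) + 1)\<bar> \<le> R + R'"
    if "u \<in> cylinder D ?q" "v \<in> cylinder D ?q" "?Q u" "\<not> ?Q v" "cylinder_dist n u v \<le> R"
      "\<And>z w. z \<in> D \<Longrightarrow> w \<in> D \<Longrightarrow> cone_dist n z w \<le> R \<Longrightarrow> \<bar>q z - q w\<bar> \<le> R'" for u v R R'
    using that(6)[of "fst u" "fst v"] cylinder_distD[OF that(5)] that(1-4) unfolding cylinder_iff by linarith+
  have "cylinder_coarse ?q (\<lambda>u. if ?Q u then ?f u else ?g u)"
  proof (rule height_coarse_glue_via[OF Y cylinder_dist_sym f g c])
    fix R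
    obtain R' where R': "0 \<le> R'" "\<And>z w. z \<in> D \<Longrightarrow> w \<in> D \<Longrightarrow> cone_dist n z w \<le> R \<Longrightarrow> \<bar>q z - q w\<bar> \<le> R'"
      using tame_heightE[OF q] by metis
    show "{(?f x, ?c x) | x y. x \<in> cylinder D ?q \<and> y \<in> cylinder D ?q \<and> ?Q x \<and> \<not> ?Q y \<and> cylinder_dist n x y \<le> R}
        \<in> entourages Y"
    proof (rule entourage_subset[OF Y cylinder_coarse_ctl[OF H, of "R + R'"]], intro subsetI)
      fix p assume "p \<in> {(?f x, ?c x) | x y. x \<in> cylinder D ?q \<and> y \<in> cylinder D ?q \<and> ?Q x \<and> \<not> ?Q y \<and> cylinder_dist n x y \<le> R}"
      then obtain x y where p: "p = (?f x, ?c x)" and xy: "x \<in> cylinder D ?q" "y \<in> cylinder D ?q" "?Q x" "\<not> ?Q y" "cylinder_dist n x y \<le> R"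
        by blast
      let ?x = "(fst x, min (snd x) (q (fst x) + 1))" and ?y = "(fst x, q (fst x) + 1)"
      have "?x \<in> cylinder D q" "?y \<in> cylinder D q"
        using xy(1) tame_height_nonneg[OF q, of "fst x"] unfolding cylinder_iff by auto
      moreover have "cylinder_dist n ?x ?y \<le> R + R'"
        using seam(1)[OF xy R'(2)] xy(3) unfolding cylinder_dist_def by auto
      ultimately show "p \<in> {(H u, H v) | u v. u \<in> cylinder D q \<and> v \<in> cylinder D q \<and> cylinder_dist n u v \<le> R + R'}"
        using p by blast
    qed
    show "{(?g y, ?c y) | x y. x \<in> cylinder D ?q \<and> y \<in> cylinder D ?q \<and> ?Q x \<and> \<not> ?Q y \<and> cylinder_dist n x y \<le> R}
        \<in> entourages Y"
    proof (rule entourage_subset[OF Y cylinder_coarse_ctl[OF H', of "R + R'"]], intro subsetI)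
      fix p assume "p \<in> {(?g y, ?c y) | x y. x \<in> cylinder D ?q \<and> y \<in> cylinder D ?q \<and> ?Q x \<and> \<not> ?Q y \<and> cylinder_dist n x y \<le> R}"
      then obtain x y where p: "p = (?g y, ?c y)" and xy: "x \<in> cylinder D ?q" "y \<in> cylinder D ?q" "?Q x" "\<not> ?Q y" "cylinder_dist n x y \<le> R"
        by blast
      let ?x = "(fst y, snd y - q (fst y) - 1)" and ?y = "(fst y, 0)"
      have y: "fst y \<in> D" using xy(2) unfolding cylinder_iff by blast
      have "?x \<in> cylinder D q'" "?y \<in> cylinder D q'"
        using xy(2,4) tame_height_nonneg[OF q', of "fst y"] unfolding cylinder_iff by auto
      moreover have "cylinder_dist n ?x ?y \<le> R + R'"
        using seam(2)[OF xy R'(2)] xy(4) unfolding cylinder_dist_def by auto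
      ultimately show "p \<in> {(H' u, H' v) | u v. u \<in> cylinder D q' \<and> v \<in> cylinder D q' \<and> cylinder_dist n u v \<le> R + R'}"
        unfolding p eq[OF y] by blast
    qed
  qed
  then show ?thesis by (rule height_coarse_cong) auto
qed

text \<open>
  Move from \<open>(z, t)\<close> to a nearby point of the cylinder over \<open>P\<close>, where \<open>H\<close> is the basepoint path.
  The time may have to be cut down to the height over the new point, by a bounded amount as \<open>q\<close> is controlled.
\<close>

lemma cylinder_near_base:
  assumes q: "tame_height n D q" and H: "cylinder_coarse q H"
    and P: "\<And>z t. z \<in> P \<Longrightarrow> 0 \<le> t \<Longrightarrow> t \<le> q z + 1 \<Longrightarrow> H (z, t) = b (snd z)"
  shows "{(H u, b (cylinder_height u)) | u. u \<in> cylinder D q \<and> (\<exists>w\<in>P. cone_dist n (fst u) w \<le> R)} \<in> entourages Y"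
proof -
  obtain R' where R': "\<And>z w. z \<in> D \<Longrightarrow> w \<in> D \<Longrightarrow> cone_dist n z w \<le> R \<Longrightarrow> \<bar>q z - q w\<bar> \<le> R'"
    using tame_heightE[OF q] by metis
  have "{(b (snd z), b (snd w)) | z w. z \<in> D \<and> w \<in> D \<and> cone_dist n z w \<le> R} \<in> entourages Y"
    using cone_coarse_base unfolding height_coarse_def by blast
  from cylinder_coarse_ctl[OF H, of "max R R'"] this show ?thesis
  proof (rule entourage_comp[OF Y])
    fix x y assume "(x, y) \<in> {(H u, b (cylinder_height u)) | u. u \<in> cylinder D q \<and> (\<exists>w\<in>P. cone_dist n (fst u) w \<le> R)}"
    then obtain z t w where xy: "x = H (z, t)" "y = b (snd z)" "(z, t) \<in> cylinder D q"
      and w: "w \<in> P" "cone_dist n z w \<le> R" by auto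
    let ?t = "min t (q w + 1)"
    have D: "z \<in> D" "w \<in> D" using xy(3) w(1) P_D unfolding cylinder_iff by auto
    have t: "0 \<le> t" "t \<le> q z + 1" using xy(3) unfolding cylinder_iff by auto
    have "0 \<le> ?t" using t tame_height_nonneg[OF q D(2)] by simp
    then have "(w, ?t) \<in> cylinder D q" and eq: "H (w, ?t) = b (snd w)"
      using D P[OF w(1)] unfolding cylinder_iff by auto
    moreover have "\<bar>t - ?t\<bar> \<le> R'" using R'[OF D w(2)] t by linarith
    then have "cylinder_dist n (z, t) (w, ?t) \<le> max R R'"
      using w(2) unfolding cylinder_dist_def by auto
    ultimately have "(x, b (snd w)) \<in> {(H u, H v) | u v. u \<in> cylinder D q \<and> v \<in> cylinder D q \<and> cylinder_dist n u v \<le> max R R'}"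
      unfolding xy(1) eq[symmetric] using xy(3) by blast
    moreover have "(b (snd w), y) \<in> {(b (snd z), b (snd w)) | z w. z \<in> D \<and> w \<in> D \<and> cone_dist n z w \<le> R}"
      unfolding xy(2) using D w(2)[unfolded cone_dist_sym[of n z w]] by blast
    ultimately show "\<exists>z. (x, z) \<in> {(H u, H v) | u v. u \<in> cylinder D q \<and> v \<in> cylinder D q \<and> cylinder_dist n u v \<le> max R R'}
        \<and> (z, y) \<in> {(b (snd z), b (snd w)) | z w. z \<in> D \<and> w \<in> D \<and> cone_dist n z w \<le> R}" by blast
  qed
qed

lemma cylinder_near_face:
  assumes "tame_height n D q" "cylinder_coarse q H" "j \<in> J"
    and "\<And>z t. z \<in> P \<Longrightarrow> 0 \<le> t \<Longrightarrow> t \<le> q z + 1 \<Longrightarrow> H (z, t) = b (snd z)"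
  shows "{(H u, b (cylinder_height u)) | u. u \<in> cylinder D q \<and>
    (fst (fst u) j \<le> R \<or> cylinder_height u - fst (fst u) j \<le> R)} \<in> entourages Y"
proof (rule entourage_subset[OF Y cylinder_near_base[OF assms(1,2,4), of "max R 0 + 1"]])
  show "{(H u, b (cylinder_height u)) | u. u \<in> cylinder D q \<and>
      (fst (fst u) j \<le> R \<or> cylinder_height u - fst (fst u) j \<le> R)}
    \<subseteq> {(H u, b (cylinder_height u)) | u. u \<in> cylinder D q \<and> (\<exists>w\<in>P. cone_dist n (fst u) w \<le> max R 0 + 1)}"
  proof
    fix p assume "p \<in> {(H u, b (cylinder_height u)) | u. u \<in> cylinder D q \<and>
      (fst (fst u) j \<le> R \<or> cylinder_height u - fst (fst u) j \<le> R)}"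
    then obtain u where u: "p = (H u, b (cylinder_height u))" "u \<in> cylinder D q"
      "fst (fst u) j \<le> R \<or> cylinder_height u - fst (fst u) j \<le> R" by blast
    then have "\<exists>w\<in>P. cone_dist n (fst u) w \<le> max R 0 + 1"
      using assms(3) by (intro P_near) (auto simp: cylinder_iff)
    then show "p \<in> {(H u, b (cylinder_height u)) | u. u \<in> cylinder D q \<and> (\<exists>w\<in>P. cone_dist n (fst u) w \<le> max R 0 + 1)}"
      using u by blast
  qed
qed

lemma cone_near_face:
  assumes "cone_coarse f" "j \<in> J" "\<And>z. z \<in> P \<Longrightarrow> f z = b (snd z)"
  shows "{(f z, b (snd z)) | z. z \<in> D \<and> (fst z j \<le> R \<or> snd z - fst z j \<le> R)} \<in> entourages Y"
proof (rule entourage_subset[OF Y cylinder_near_face[OF tame_height_snd[OF D_cube] cylinder_coarse_const[OF assms(1)] assms(2)]])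
  show "{(f z, b (snd z)) | z. z \<in> D \<and> (fst z j \<le> R \<or> snd z - fst z j \<le> R)}
    \<subseteq> {(f (fst u), b (cylinder_height u)) | u. u \<in> cylinder D snd \<and>
      (fst (fst u) j \<le> R \<or> cylinder_height u - fst (fst u) j \<le> R)}" (is "_ \<subseteq> ?B")
  proof
    fix p assume "p \<in> {(f z, b (snd z)) | z. z \<in> D \<and> (fst z j \<le> R \<or> snd z - fst z j \<le> R)}"
    then obtain z where z: "p = (f z, b (snd z))" "z \<in> D" "fst z j \<le> R \<or> snd z - fst z j \<le> R" by blast
    then have "(z, 0) \<in> cylinder D snd" using D_height unfolding cylinder_iff by (simp add: add_nonneg_nonneg)
    then show "p \<in> ?B" using z by (intro CollectI exI[of _ "(z, 0)"]) auto
  qed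
qed (use assms(3) in auto)

text \<open>
  Points \<open>u\<close>, \<open>v\<close> at distance at most \<open>R\<close> on different sides of the middle have coordinates within
  \<open>3 R / 2\<close> of it, so after doubling they are within \<open>3 R\<close> of the faces, where both homotopies are
  close to the basepoint path.
\<close>

lemma cylinder_coarse_concat:
  assumes q: "tame_height n D q" and q': "tame_height n D q'" and j: "j \<in> J"
    and H: "cylinder_coarse q H" and H': "cylinder_coarse q' H'"
    and P: "\<And>z t. z \<in> P \<Longrightarrow> 0 \<le> t \<Longrightarrow> t \<le> q z + 1 \<Longrightarrow> H (z, t) = b (snd z)"
    and P': "\<And>z t. z \<in> P \<Longrightarrow> 0 \<le> t \<Longrightarrow> t \<le> q' z + 1 \<Longrightarrow> H' (z, t) = b (snd z)"
  shows "cylinder_coarse (concat_height j q q')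
    (\<lambda>u. if fst (fst u) j \<le> snd (fst u) / 2
      then H (lower_half j (fst u), min (snd u) (q (lower_half j (fst u)) + 1))
      else H' (upper_half j (fst u), min (snd u) (q' (upper_half j (fst u)) + 1)))"
proof -
  let ?q = "concat_height j q q'"
  let ?Q = "\<lambda>u::cone_point \<times> real. fst (fst u) j \<le> snd (fst u) / 2"
  let ?c = "\<lambda>u::cone_point \<times> real. b (cylinder_height u)"
  have half: "height_coarse {u \<in> cylinder D ?q. Q u} (cylinder_dist n) cylinder_height Y
      (\<lambda>u. K (reparam j s (fst u), min (snd u) (r (reparam j s (fst u)) + 1)))"
    if r: "tame_height n D r" and K: "cylinder_coarse r K" and s: "reparametrization s" for r K s Q
  proof (rule cylinder_coarse_compose[OF K])
    fix R
    have "cone_dist n (reparam j s (fst u)) (reparam j s (fst v)) \<le> 4 * R" if "cylinder_dist n u v \<le> R" for u v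
      using reparam_dist[OF s J_less[OF j], of "fst u" "fst v"] cylinder_distD[OF that] by linarith
    then show "\<exists>R'. \<forall>u\<in>cylinder D ?q. \<forall>v\<in>cylinder D ?q. cylinder_dist n u v \<le> R \<longrightarrow>
        cone_dist n (reparam j s (fst u)) (reparam j s (fst v)) \<le> R'" by blast
    obtain R' where R': "\<And>z w. z \<in> D \<Longrightarrow> w \<in> D \<Longrightarrow> cone_dist n z w \<le> R \<Longrightarrow>
        \<bar>r (reparam j s z) - r (reparam j s w)\<bar> \<le> R'"
      using tame_heightE[OF tame_height_reparam[OF r j s]] by metis
    have "\<bar>min (snd u) (r (reparam j s (fst u)) + 1) - min (snd v) (r (reparam j s (fst v)) + 1)\<bar> \<le> max R R'"
      if "u \<in> cylinder D ?q" "v \<in> cylinder D ?q" "cylinder_dist n u v \<le> R" for u v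
      using R'[of "fst u" "fst v"] cylinder_distD[OF that(3)] that(1,2) unfolding cylinder_iff by linarith
    then show "\<exists>R'. \<forall>u\<in>cylinder D ?q. \<forall>v\<in>cylinder D ?q. cylinder_dist n u v \<le> R \<longrightarrow>
        \<bar>min (snd u) (r (reparam j s (fst u)) + 1) - min (snd v) (r (reparam j s (fst v)) + 1)\<bar> \<le> R'"
      by blast
  next
    show "(reparam j s (fst u), min (snd u) (r (reparam j s (fst u)) + 1)) \<in> cylinder D r"
      if "u \<in> cylinder D ?q" for u
      using that reparam_D[OF _ j s, of "fst u"] tame_height_nonneg[OF r, of "reparam j s (fst u)"]
      unfolding cylinder_iff by auto
  qed auto
  have "height_coarse {u \<in> cylinder D ?q. True} (cylinder_dist n) cylinder_height Y
      (\<lambda>u. H (lower_half j (fst u), min (snd u) (q (lower_half j (fst u)) + 1)))"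
    by (rule half[OF q H reparametrization_halves(1)])
  then have f: "cylinder_coarse ?q (\<lambda>u. H (lower_half j (fst u), min (snd u) (q (lower_half j (fst u)) + 1)))"
    by simp
  have g: "height_coarse {u \<in> cylinder D ?q. \<not> ?Q u} (cylinder_dist n) cylinder_height Y
      (\<lambda>u. H' (upper_half j (fst u), min (snd u) (q' (upper_half j (fst u)) + 1)))"
    by (rule half[OF q' H' reparametrization_halves(2)])
  have c: "cylinder_coarse ?q ?c" by (rule cylinder_coarse_const[OF cone_coarse_base])
  have seam: "snd (fst u) - 2 * fst (fst u) j \<le> 3 * R" "2 * fst (fst v) j - snd (fst v) \<le> 3 * R"
    if "?Q u" "\<not> ?Q v" "cylinder_dist n u v \<le> R" for u v R
    using that(1,2) cylinder_distD[OF that(3)] coord_le_cone_dist[OF J_less[OF j], of "fst u" "fst v"]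
      height_le_cone_dist[of "fst u" "fst v" n] by linarith+
  show ?thesis
  proof (rule height_coarse_glue_via[OF Y cylinder_dist_sym f g c])
    fix R
    show "{(H (lower_half j (fst x), min (snd x) (q (lower_half j (fst x)) + 1)), ?c x) | x y.
        x \<in> cylinder D ?q \<and> y \<in> cylinder D ?q \<and> ?Q x \<and> \<not> ?Q y \<and> cylinder_dist n x y \<le> R} \<in> entourages Y"
    proof (rule entourage_subset[OF Y cylinder_near_face[OF q H j P, of "3 * R"]], safe)
      fix u v assume uv: "u \<in> cylinder D ?q" "v \<in> cylinder D ?q" "?Q u" "\<not> ?Q v" "cylinder_dist n u v \<le> R"
      let ?u = "(lower_half j (fst u), min (snd u) (q (lower_half j (fst u)) + 1))"
      have "?u \<in> cylinder D q"
        using uv(1) reparam_D[OF _ j reparametrization_halves(1), of "fst u"]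
          tame_height_nonneg[OF q, of "lower_half j (fst u)"] unfolding cylinder_iff by auto
      moreover have "cylinder_height ?u - fst (fst ?u) j \<le> 3 * R"
        using seam(1)[OF uv(3-5)] uv(3) by (simp add: reparam_def)
      ultimately show "\<exists>w. (H ?u, ?c u) = (H w, ?c w) \<and> w \<in> cylinder D q \<and>
          (fst (fst w) j \<le> 3 * R \<or> cylinder_height w - fst (fst w) j \<le> 3 * R)"
        by (intro exI[of _ ?u]) auto
    qed
    show "{(H' (upper_half j (fst y), min (snd y) (q' (upper_half j (fst y)) + 1)), ?c y) | x y.
        x \<in> cylinder D ?q \<and> y \<in> cylinder D ?q \<and> ?Q x \<and> \<not> ?Q y \<and> cylinder_dist n x y \<le> R} \<in> entourages Y"
    proof (rule entourage_subset[OF Y cylinder_near_face[OF q' H' j P', of "3 * R"]], safe)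
      fix u v assume uv: "u \<in> cylinder D ?q" "v \<in> cylinder D ?q" "?Q u" "\<not> ?Q v" "cylinder_dist n u v \<le> R"
      let ?v = "(upper_half j (fst v), min (snd v) (q' (upper_half j (fst v)) + 1))"
      have "?v \<in> cylinder D q'"
        using uv(2) reparam_D[OF _ j reparametrization_halves(2), of "fst v"]
          tame_height_nonneg[OF q', of "upper_half j (fst v)"] unfolding cylinder_iff by auto
      moreover have "fst (fst ?v) j \<le> 3 * R"
        using seam(2)[OF uv(3-5)] uv(4) by (simp add: reparam_def)
      ultimately show "\<exists>w. (H' ?v, ?c v) = (H' w, ?c w) \<and> w \<in> cylinder D q' \<and>
          (fst (fst w) j \<le> 3 * R \<or> cylinder_height w - fst (fst w) j \<le> 3 * R)"
        by (intro exI[of _ ?v]) auto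
    qed
  qed
qed

lemma cone_coarse_reparam:
  assumes "cone_coarse f" "j \<in> J" "reparametrization s"
  shows "cone_coarse (\<lambda>z. f (reparam j s z))"
proof (rule height_coarse_compose[OF Y assms(1)])
  fix R
  have "cone_dist n (reparam j s z) (reparam j s w) \<le> 4 * R" if "cone_dist n z w \<le> R" for z w
    using reparam_dist[OF assms(3) J_less[OF assms(2)], of z w] that by linarith
  then show "\<exists>R'. \<forall>z\<in>D. \<forall>w\<in>D. cone_dist n z w \<le> R \<longrightarrow> cone_dist n (reparam j s z) (reparam j s w) \<le> R'"
    by blast
qed (use reparam_D assms in auto)

text \<open>
  On the faces \<open>s0\<close> and \<open>s1\<close> agree, so nothing moves there; this keeps the homotopy within the
  boundary cone and within \<open>P\<close>.
\<close>

lemma slide_bounds: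
  assumes "reparametrization s0" "reparametrization s1"
    "\<And>h. 0 \<le> h \<Longrightarrow> s0 0 h = s1 0 h \<and> s0 h h = s1 h h"
    "0 \<le> x" "x \<le> h" "0 \<le> t"
  shows "0 \<le> slide s0 s1 t x h" "slide s0 s1 t x h \<le> h"
    "x \<in> {0, h} \<longrightarrow> slide s0 s1 t x h \<in> {0, h}"
proof -
  have "0 \<le> s0 x h \<and> s0 x h \<le> h" "0 \<le> s1 x h \<and> s1 x h \<le> h"
    using assms unfolding reparametrization_def by blast+
  then show "0 \<le> slide s0 s1 t x h" "slide s0 s1 t x h \<le> h"
    using assms(6) unfolding slide_def by linarith+
  have "slide s0 s1 t x h = s0 x h" if "x \<in> {0, h}"
    using that assms(3)[of h] assms(4-6) unfolding slide_def by auto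
  then show "x \<in> {0, h} \<longrightarrow> slide s0 s1 t x h \<in> {0, h}"
    using assms(1,4,5) unfolding reparametrization_def by auto
qed

lemma slide_D:
  assumes "reparametrization s0" "reparametrization s1"
    "\<And>h. 0 \<le> h \<Longrightarrow> s0 0 h = s1 0 h \<and> s0 h h = s1 h h" "z \<in> D" "j \<in> J" "0 \<le> t"
  shows "reparam j (slide s0 s1 t) z \<in> D"
  unfolding reparam_def using slide_bounds[OF assms(1-3), of "fst z j" "snd z" t] D_coord[OF assms(4,5)] assms(4-6)
  by (intro D_stable) auto

lemma slide_P:
  assumes "reparametrization s0" "reparametrization s1"
    "\<And>h. 0 \<le> h \<Longrightarrow> s0 0 h = s1 0 h \<and> s0 h h = s1 h h" "z \<in> P" "j \<in> J" "0 \<le> t"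
  shows "reparam j (slide s0 s1 t) z \<in> P"
proof -
  have "z \<in> D" using assms(4) P_D by blast
  then show ?thesis
    unfolding reparam_def using slide_bounds[OF assms(1-3), of "fst z j" "snd z" t] D_coord[OF _ assms(5)] assms(4-6)
    by (intro P_stable) auto
qed

lemma cylinder_coarse_slide:
  assumes f: "cone_coarse f" and j: "j \<in> J" and s: "reparametrization s0" "reparametrization s1"
    "\<And>h. 0 \<le> h \<Longrightarrow> s0 0 h = s1 0 h \<and> s0 h h = s1 h h"
  shows "cylinder_coarse q (\<lambda>u. f (reparam j (slide s0 s1 (snd u)) (fst u)))"
proof (rule height_coarse_compose[OF Y f])
  fix R
  have "cone_dist n (reparam j (slide s0 s1 (snd u)) (fst u)) (reparam j (slide s0 s1 (snd v)) (fst v)) \<le> 5 * R"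
    if "cylinder_dist n u v \<le> R" for u v
  proof -
    have "\<bar>s (fst (fst u) j) (snd (fst u)) - s (fst (fst v) j) (snd (fst v))\<bar> \<le> 3 * R"
      if "reparametrization s" for s
    proof -
      have "\<bar>s (fst (fst u) j) (snd (fst u)) - s (fst (fst v) j) (snd (fst v))\<bar>
          \<le> 2 * \<bar>fst (fst u) j - fst (fst v) j\<bar> + \<bar>snd (fst u) - snd (fst v)\<bar>"
        using that unfolding reparametrization_def by blast
      then show ?thesis
        using cylinder_distD[OF \<open>cylinder_dist n u v \<le> R\<close>] height_le_cone_dist[of "fst u" "fst v" n]
          coord_le_cone_dist[OF J_less[OF j], of "fst u" "fst v"] by (smt (verit))
    qed
    from this[OF s(1)] this[OF s(2)]
    have "\<bar>slide s0 s1 (snd u) (fst (fst u) j) (snd (fst u)) - slide s0 s1 (snd v) (fst (fst v) j) (snd (fst v))\<bar> \<le> 4 * R"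
      using cylinder_distD[OF that] unfolding slide_def by linarith
    then show ?thesis
      using cylinder_distD[OF that] cone_dist_set_coord[of n j _ "fst u" _ "fst v"]
      unfolding reparam_def by (smt (verit, best))
  qed
  then show "\<exists>R'. \<forall>u\<in>cylinder D q. \<forall>v\<in>cylinder D q. cylinder_dist n u v \<le> R \<longrightarrow>
      cone_dist n (reparam j (slide s0 s1 (snd u)) (fst u)) (reparam j (slide s0 s1 (snd v)) (fst v)) \<le> R'"
    by blast
next
  show "reparam j (slide s0 s1 (snd u)) (fst u) \<in> D" if "u \<in> cylinder D q" for u
    using that slide_D[OF s _ j] unfolding cylinder_iff by blast
qed auto

text \<open>
  The homotopy is \<open>f\<close> at all times but the last one, where it jumps to \<open>g\<close>.
\<close>

lemma cylinder_coarse_close: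
  assumes f: "cone_coarse f" and g: "cone_coarse g"
    and close: "{(f z, g z) | z. z \<in> D} \<in> entourages Y"
  shows "cylinder_coarse q (\<lambda>u. if snd u < q (fst u) + 1 then f (fst u) else g (fst u))"
proof -
  let ?Q = "\<lambda>u. snd u < q (fst u) + 1"
  have f': "cylinder_coarse q (\<lambda>u. f (fst u))" and g': "cylinder_coarse q (\<lambda>u. g (fst u))"
    using f g cylinder_coarse_const by blast+
  have g'': "height_coarse {u \<in> cylinder D q. \<not> ?Q u} (cylinder_dist n) cylinder_height Y (\<lambda>u. g (fst u))"
    by (rule height_coarse_subset[OF Y g']) auto
  have gf: "{(g z, f z) | z. z \<in> D} \<in> entourages Y"
    by (rule entourage_subset[OF Y entourage_converse[OF Y close]]) blast
  have "\<forall>x\<in>D. f x \<in> carrier Y" using f unfolding height_coarse_def by blast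
  then have ff: "{(f z, f z) | z. z \<in> D} \<in> entourages Y"
    by (intro entourage_subset[OF Y entourage_diagonal[OF Y]]) (auto simp: Id_on_def)
  show ?thesis
  proof (rule height_coarse_glue_via[OF Y cylinder_dist_sym f' g'' f'])
    fix R
    show "{(f (fst x), f (fst x)) | x y. x \<in> cylinder D q \<and> y \<in> cylinder D q \<and> ?Q x \<and> \<not> ?Q y \<and> cylinder_dist n x y \<le> R} \<in> entourages Y"
      by (rule entourage_subset[OF Y ff]) (auto simp: cylinder_iff)
    show "{(g (fst y), f (fst y)) | x y. x \<in> cylinder D q \<and> y \<in> cylinder D q \<and> ?Q x \<and> \<not> ?Q y \<and> cylinder_dist n x y \<le> R} \<in> entourages Y"
      by (rule entourage_subset[OF Y gf]) (auto simp: cylinder_iff)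
  qed
qed

abbreviation "concat_on j F G \<equiv> restrict (coord_concat j F G) D"
abbreviation "pull j s F \<equiv> restrict (\<lambda>z. F (reparam j s z)) D"

lemma half_D: "z \<in> D \<Longrightarrow> j \<in> J \<Longrightarrow> lower_half j z \<in> D" "z \<in> D \<Longrightarrow> j \<in> J \<Longrightarrow> upper_half j z \<in> D"
  using reparam_D reparametrization_halves by blast+

lemma half_P: "z \<in> P \<Longrightarrow> j \<in> J \<Longrightarrow> lower_half j z \<in> P" "z \<in> P \<Longrightarrow> j \<in> J \<Longrightarrow> upper_half j z \<in> P"
  using reparam_P reparametrization_halves by blast+

lemma coord_concat_cong:
  assumes "z \<in> D" "j \<in> J" "\<And>w. w \<in> D \<Longrightarrow> F w = F' w" "\<And>w. w \<in> D \<Longrightarrow> G w = G' w"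
  shows "coord_concat j F G z = coord_concat j F' G' z"
  using assms half_D[OF assms(1,2)] unfolding coord_concat_def by simp

lemma concat_on_assoc:
  assumes "j \<in> J"
  shows "pull j assoc_shift (concat_on j (concat_on j F G) H) = concat_on j F (concat_on j G H)"
proof (rule restrict_ext)
  fix z assume z: "z \<in> D"
  have r: "reparam j assoc_shift z \<in> D" by (rule reparam_D[OF z assms reparametrization_assoc])
  have "concat_on j (concat_on j F G) H (reparam j assoc_shift z)
      = coord_concat j (coord_concat j F G) H (reparam j assoc_shift z)"
    using r by (simp add: coord_concat_cong[OF r assms, of "concat_on j F G" "coord_concat j F G" H H])
  also have "\<dots> = coord_concat j F (coord_concat j G H) z"
    using D_coord[OF z assms] by (intro coord_concat_assoc) auto
  also have "\<dots> = coord_concat j F (concat_on j G H) z"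
    by (rule coord_concat_cong[OF z assms]) auto
  finally show "concat_on j (concat_on j F G) H (reparam j assoc_shift z) = coord_concat j F (concat_on j G H) z" .
qed

lemma concat_on_interchange:
  assumes "i \<in> J" "j \<in> J" "i \<noteq> j"
  shows "concat_on i (concat_on j F G) (concat_on j F' G') = concat_on j (concat_on i F F') (concat_on i G G')"
proof (rule restrict_ext)
  fix z assume z: "z \<in> D"
  have "coord_concat i (concat_on j F G) (concat_on j F' G') z
      = coord_concat i (coord_concat j F G) (coord_concat j F' G') z"
    by (rule coord_concat_cong[OF z assms(1)]) auto
  also have "\<dots> = coord_concat j (coord_concat i F F') (coord_concat i G G') z"
    by (rule coord_concat_interchange[OF assms(3)])
  also have "\<dots> = coord_concat j (concat_on i F F') (concat_on i G G') z"
    by (rule coord_concat_cong[OF z assms(2)]) auto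
  finally show "coord_concat i (concat_on j F G) (concat_on j F' G') z
    = coord_concat j (concat_on i F F') (concat_on i G G') z" .
qed

text \<open>
  A path run backwards and then forwards is the path pulled back along the folding map.
\<close>

lemma concat_on_inverse:
  assumes "j \<in> J"
  shows "concat_on j (pull j (\<lambda>x h. h - x) F) F = pull j (\<lambda>x h. \<bar>2 * x - h\<bar>) F"
proof (rule restrict_ext)
  fix z assume z: "z \<in> D"
  show "coord_concat j (pull j (\<lambda>x h. h - x) F) F z = F (reparam j (\<lambda>x h. \<bar>2 * x - h\<bar>) z)"
    using half_D[OF z assms]
    by (auto simp: coord_concat_def reparam_reparam intro!: arg_cong[of _ _ F] reparam_cong)
qed

lemma pull_ident: "F \<in> extensional D \<Longrightarrow> pull j (\<lambda>x h. x) F = F"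
  by (simp add: reparam_ident extensional_restrict)

text \<open>
  Regard both maps as constant homotopies, concatenate, and take the slice at time 0.
\<close>

lemma cone_coarse_concat:
  assumes F: "cone_coarse F" "\<And>z. z \<in> P \<Longrightarrow> F z = b (snd z)"
    and G: "cone_coarse G" "\<And>z. z \<in> P \<Longrightarrow> G z = b (snd z)" and j: "j \<in> J"
  shows "cone_coarse (concat_on j F G)"
proof -
  have t: "tame_height n D snd" by (rule tame_height_snd[OF D_cube])
  note K = cylinder_coarse_concat[OF t t j cylinder_coarse_const[OF F(1)] cylinder_coarse_const[OF G(1)]]
  have "cone_coarse (\<lambda>z. if fst z j \<le> snd z / 2 then F (lower_half j z) else G (upper_half j z))"
    using cone_coarse_slice[OF tame_height_concat[OF t t j] K, unfolded fst_conv] F(2) G(2) by blast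
  then show ?thesis by (rule height_coarse_cong) (simp add: coord_concat_def)
qed

lemma close_diagonal: "cone_coarse f \<Longrightarrow> {(f z, f z) | z. z \<in> D} \<in> entourages Y"
  by (rule entourage_subset[OF Y entourage_diagonal[OF Y]]) (auto simp: Id_on_def height_coarse_def)

lemma close_face:
  assumes "cone_coarse f" "\<And>z. z \<in> P \<Longrightarrow> f z = b (snd z)" "j \<in> J"
  shows "{(f z, b (snd z)) | z. z \<in> D \<and> (fst z j = 0 \<or> fst z j = snd z)} \<in> entourages Y"
proof (rule entourage_subset[OF Y], rule cone_near_face[OF assms(1,3)], rule assms(2), assumption, rule subsetI)
  fix p assume "p \<in> {(f z, b (snd z)) | z. z \<in> D \<and> (fst z j = 0 \<or> fst z j = snd z)}"
  then obtain z where "p = (f z, b (snd z))" "z \<in> D" "fst z j = 0 \<or> fst z j = snd z" by blast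
  then show "p \<in> {(f z, b (snd z)) | z. z \<in> D \<and> (fst z j \<le> 0 \<or> snd z - fst z j \<le> 0)}"
    by (intro CollectI exI[of _ z]) auto
qed

text \<open>
  On its first half the pulled back map takes its values on the face \<open>x\<^sub>j = 0\<close>, where \<open>f\<close> is close
  to the basepoint path; on the second half the two maps coincide. For the unit on the right the
  halves are exchanged, and the face is \<open>x\<^sub>j = h\<close>.
\<close>

lemma close_unit_left:
  assumes "cone_coarse f" "\<And>z. z \<in> P \<Longrightarrow> f z = b (snd z)" "j \<in> J"
    and e: "\<And>z. z \<in> D \<Longrightarrow> e z = b (snd z)"
  shows "{(concat_on j e f z, pull j (\<lambda>x h. max (2 * x - h) 0) f z) | z. z \<in> D} \<in> entourages Y"
proof (rule entourage_subset[OF Y entourage_Un[OF Y close_diagonal[OF assms(1)]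
      entourage_converse[OF Y close_face[OF assms(1) _ assms(3)]]]], rule assms(2), assumption, rule subsetI)
  fix p assume "p \<in> {(concat_on j e f z, pull j (\<lambda>x h. max (2 * x - h) 0) f z) | z. z \<in> D}"
  then obtain z where p: "p = (concat_on j e f z, pull j (\<lambda>x h. max (2 * x - h) 0) f z)" and z: "z \<in> D" by blast
  let ?w = "upper_half j z" and ?N = "{(f z, b (snd z)) | z. z \<in> D \<and> (fst z j = 0 \<or> fst z j = snd z)}"
  have w: "?w \<in> D" by (rule half_D(2)[OF z assms(3)])
  show "p \<in> {(f z, f z) | z. z \<in> D} \<union> ?N\<inverse>"
  proof (cases "fst z j \<le> snd z / 2")
    case half: True
    have "fst ?w j = 0" using half by (simp add: fst_reparam)
    then have "(f ?w, b (snd ?w)) \<in> ?N" using w by blast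
    moreover have "p = (b (snd ?w), f ?w)"
      using p half z e[OF half_D(1)[OF z assms(3)]] by (simp add: coord_concat_def)
    ultimately show ?thesis by blast
  next
    case False
    then have "p = (f ?w, f ?w)" using p z by (simp add: coord_concat_def)
    then show ?thesis using w by blast
  qed
qed

lemma close_unit_right:
  assumes "cone_coarse f" "\<And>z. z \<in> P \<Longrightarrow> f z = b (snd z)" "j \<in> J"
    and e: "\<And>z. z \<in> D \<Longrightarrow> e z = b (snd z)"
  shows "{(concat_on j f e z, pull j (\<lambda>x h. min (2 * x) h) f z) | z. z \<in> D} \<in> entourages Y"
proof (rule entourage_subset[OF Y entourage_Un[OF Y close_diagonal[OF assms(1)]
      entourage_converse[OF Y close_face[OF assms(1) _ assms(3)]]]], rule assms(2), assumption, rule subsetI)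
  fix p assume "p \<in> {(concat_on j f e z, pull j (\<lambda>x h. min (2 * x) h) f z) | z. z \<in> D}"
  then obtain z where p: "p = (concat_on j f e z, pull j (\<lambda>x h. min (2 * x) h) f z)" and z: "z \<in> D" by blast
  let ?w = "lower_half j z" and ?N = "{(f z, b (snd z)) | z. z \<in> D \<and> (fst z j = 0 \<or> fst z j = snd z)}"
  have w: "?w \<in> D" by (rule half_D(1)[OF z assms(3)])
  show "p \<in> {(f z, f z) | z. z \<in> D} \<union> ?N\<inverse>"
  proof (cases "fst z j \<le> snd z / 2")
    case True
    then have "p = (f ?w, f ?w)" using p z by (simp add: coord_concat_def)
    then show ?thesis using w by blast
  next
    case half: False
    have "fst ?w j = snd ?w" using half by (simp add: fst_reparam)
    then have "(f ?w, b (snd ?w)) \<in> ?N" using w by blast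
    moreover have "p = (b (snd ?w), f ?w)"
      using p half z e[OF half_D(2)[OF z assms(3)]] by (simp add: coord_concat_def)
    ultimately show ?thesis by blast
  qed
qed

lemma close_top_face:
  assumes "cone_coarse f" "\<And>z. z \<in> P \<Longrightarrow> f z = b (snd z)" "j \<in> J"
    and e: "\<And>z. z \<in> D \<Longrightarrow> e z = b (snd z)"
  shows "{(pull j (\<lambda>x h. h) f z, e z) | z. z \<in> D} \<in> entourages Y"
proof (rule entourage_subset[OF Y close_face[OF assms(1-3)]], safe)
  fix z :: cone_point assume z: "z \<in> D"
  show "\<exists>w. (pull j (\<lambda>x h. h) f z, e z) = (f w, b (snd w)) \<and> w \<in> D \<and> (fst w j = 0 \<or> fst w j = snd w)"
    using z e reparam_D[OF z assms(3) reparametrization_top]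
    by (intro exI[of _ "reparam j (\<lambda>x h. h) z"]) (simp add: fst_reparam)
qed

lemma coarse_map_iff: "coarse_map (metric_coarse D (cone_dist n)) Y f \<longleftrightarrow> cone_coarse f"
  by (rule coarse_map_iff_height_coarse[OF Y height_gauge_cone[OF D_cube origin]])

lemma coarse_homotopy_iff:
  "coarse_homotopy (metric_coarse D (cone_dist n)) Y q f0 f1 H \<longleftrightarrow>
    tame_height n D q \<and> cylinder_coarse q H \<and> (\<forall>z\<in>D. H (z, 0) = f0 z \<and> H (z, q z + 1) = f1 z)"
proof -
  have "carrier (metric_coarse D (cone_dist n)) = D" unfolding metric_coarse_def by simp
  then show ?thesis
    unfolding coarse_homotopy_def coarse_map_rplus_iff_tame[OF D_cube origin] coarse_cylinder_metric
    using coarse_map_iff_height_coarse[OF Y height_gauge_cylinder[OF D_cube origin]] by auto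
qed

end

section \<open>Homotopy classes of maps of pairs\<close>

lemma cube_cone_set_coord:
  assumes "z \<in> cube_cone n" "j < n" "0 \<le> r" "r \<le> snd z"
  shows "set_coord j r z \<in> cube_cone n"
  using assms unfolding cube_cone_iff set_coord_def by auto

lemma boundary_cone_set_coord:
  assumes "n \<ge> 1" "z \<in> boundary_cone n" "j < n" "0 \<le> r" "r \<le> snd z"
    "fst z j \<in> {0, snd z} \<longrightarrow> r \<in> {0, snd z}"
  shows "set_coord j r z \<in> boundary_cone n"
proof -
  obtain i where i: "i < n" "fst z i = 0 \<or> fst z i = snd z" and z: "z \<in> cube_cone n"
    using assms(2) unfolding boundary_cone_iff[OF assms(1)] by blast
  have "fst (set_coord j r z) i = 0 \<or> fst (set_coord j r z) i = snd z"
    using i assms(6) by (cases "i = j") auto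
  then show ?thesis
    using i(1) cube_cone_set_coord[OF z assms(3-5)] unfolding boundary_cone_iff[OF assms(1)] by auto
qed

text \<open>
  Here \<open>P\<close> is the part of the boundary cone where the second component of a map of pairs is the basepoint path. The
  assumptions are those of \<open>based_domain\<close>, stated once for the cube cone and the boundary cone.
\<close>

locale pair_setting =
  fixes n :: nat and P :: "cone_point set" and J :: "nat set"
    and X :: "'a coarse" and A :: "'b coarse" and k :: "'b \<Rightarrow> 'a" and i0 :: "real \<Rightarrow> 'b"
  assumes n: "n \<ge> 1"
    and pair: "coarse_pair X A k"
    and basepoint: "coarse_map rplus A i0"
    and P_boundary: "P \<subseteq> boundary_cone n"
    and J_n: "j \<in> J \<Longrightarrow> j < n"
    and P_set_coord: "\<lbrakk>z \<in> P; j \<in> J; 0 \<le> r; r \<le> snd z; fst z j \<in> {0, snd z} \<longrightarrow> r \<in> {0, snd z}\<rbrakk>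
      \<Longrightarrow> set_coord j r z \<in> P"
    and face_near_P: "\<lbrakk>z \<in> cube_cone n; j \<in> J; 0 \<le> R; fst z j \<le> R \<or> snd z - fst z j \<le> R\<rbrakk>
      \<Longrightarrow> \<exists>w\<in>P. cone_dist n z w \<le> R + 1"
begin

lemma boundary_cube: "boundary_cone n \<subseteq> cube_cone n"
  using boundary_cone_iff[OF n] by blast

sublocale cube: based_domain n P "cube_cone n" J X "\<lambda>r. k (i0 r)"
proof
  show "coarse_space X" using pair unfolding coarse_pair_def by blast
  show "coarse_map rplus X (\<lambda>r. k (i0 r))" 
    by (rule coarse_map_compose[OF basepoint]) (use pair in \<open>simp add: coarse_pair_def\<close>)
  show "P \<subseteq> cube_cone n" using P_boundary boundary_cube by blast
  show "(\<lambda>_. 0, 0) \<in> cube_cone n" unfolding cube_cone_iff by simp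
  show "set_coord j r z \<in> cube_cone n" if "z \<in> cube_cone n" "j \<in> J" "0 \<le> r" "r \<le> snd z" for z j r
    by (rule cube_cone_set_coord[OF that(1) J_n[OF that(2)] that(3,4)])
qed (fact subset_refl J_n P_set_coord face_near_P)+

sublocale boundary: based_domain n P "boundary_cone n" J A i0
proof
  show "coarse_space A" using pair unfolding coarse_pair_def by blast
  show "(\<lambda>_. 0, 0) \<in> boundary_cone n" unfolding boundary_cone_iff[OF n] cube_cone_iff
    using n by (auto intro!: exI[of _ 0])
  show "set_coord j r z \<in> boundary_cone n"
    if "z \<in> boundary_cone n" "j \<in> J" "0 \<le> r" "r \<le> snd z" "fst z j \<in> {0, snd z} \<longrightarrow> r \<in> {0, snd z}" for z j r
    by (rule boundary_cone_set_coord[OF n that(1) J_n[OF that(2)] that(3-5)])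
  show "\<exists>w\<in>P. cone_dist n z w \<le> R + 1"
    if "z \<in> boundary_cone n" "j \<in> J" "0 \<le> R" "fst z j \<le> R \<or> snd z - fst z j \<le> R" for z j R
    using that boundary_cube by (intro face_near_P) auto
qed (fact basepoint P_boundary boundary_cube J_n P_set_coord)+

definition pair_maps :: "('a, 'b) pair_map set" where
  "pair_maps = {a. fst a \<in> extensional (cube_cone n) \<and> snd a \<in> extensional (boundary_cone n) \<and>
     cube.cone_coarse (fst a) \<and> boundary.cone_coarse (snd a) \<and>
     (\<forall>z\<in>boundary_cone n. fst a z = k (snd a z)) \<and> (\<forall>z\<in>P. snd a z = i0 (snd z))}"

definition pair_homotopy ::
  "(cone_point \<Rightarrow> real) \<Rightarrow> (cone_point \<times> real \<Rightarrow> 'a) \<Rightarrow> (cone_point \<times> real \<Rightarrow> 'b) \<Rightarrow> bool" where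
  "pair_homotopy q H HA \<longleftrightarrow> tame_height n (cube_cone n) q \<and>
     cube.cylinder_coarse q H \<and> boundary.cylinder_coarse q HA \<and>
     (\<forall>z\<in>boundary_cone n. \<forall>t\<in>{0..q z + 1}. H (z, t) = k (HA (z, t))) \<and>
     (\<forall>z\<in>P. \<forall>t\<in>{0..q z + 1}. HA (z, t) = i0 (snd z))"

definition pair_rel :: "(('a, 'b) pair_map \<times> ('a, 'b) pair_map) set" where
  "pair_rel = {(a, b). a \<in> pair_maps \<and> b \<in> pair_maps \<and> (\<exists>q H HA. pair_homotopy q H HA \<and>
     (\<forall>z\<in>cube_cone n. H (z, 0) = fst a z \<and> H (z, q z + 1) = fst b z) \<and>
     (\<forall>z\<in>boundary_cone n. HA (z, 0) = snd a z \<and> HA (z, q z + 1) = snd b z))}"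

lemma pair_relI:
  assumes "a \<in> pair_maps" "b \<in> pair_maps" "pair_homotopy q H HA"
    "\<And>z. z \<in> cube_cone n \<Longrightarrow> H (z, 0) = fst a z \<and> H (z, q z + 1) = fst b z"
    "\<And>z. z \<in> boundary_cone n \<Longrightarrow> HA (z, 0) = snd a z \<and> HA (z, q z + 1) = snd b z"
  shows "(a, b) \<in> pair_rel"
  unfolding pair_rel_def using assms by blast

lemma pair_homotopyD:
  assumes "pair_homotopy q H HA"
  shows "tame_height n (cube_cone n) q" "tame_height n (boundary_cone n) q"
    "cube.cylinder_coarse q H" "boundary.cylinder_coarse q HA"
    "\<And>z t. z \<in> boundary_cone n \<Longrightarrow> 0 \<le> t \<Longrightarrow> t \<le> q z + 1 \<Longrightarrow> H (z, t) = k (HA (z, t))"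
    "\<And>z t. z \<in> P \<Longrightarrow> 0 \<le> t \<Longrightarrow> t \<le> q z + 1 \<Longrightarrow> HA (z, t) = i0 (snd z)"
    "\<And>z t. z \<in> P \<Longrightarrow> 0 \<le> t \<Longrightarrow> t \<le> q z + 1 \<Longrightarrow> H (z, t) = k (i0 (snd z))"
  using assms P_boundary tame_height_subset[OF _ boundary_cube, where q = q]
  unfolding pair_homotopy_def by (auto simp: subset_iff)

lemma pair_mapsD:
  assumes "a \<in> pair_maps"
  shows "fst a \<in> extensional (cube_cone n)" "snd a \<in> extensional (boundary_cone n)"
    "cube.cone_coarse (fst a)" "boundary.cone_coarse (snd a)"
    "\<And>z. z \<in> boundary_cone n \<Longrightarrow> fst a z = k (snd a z)"
    "\<And>z. z \<in> P \<Longrightarrow> snd a z = i0 (snd z)" "\<And>z. z \<in> P \<Longrightarrow> fst a z = k (i0 (snd z))"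
  using assms P_boundary unfolding pair_maps_def by (auto simp: subset_iff)

lemma tame_snd: "tame_height n (cube_cone n) snd" "tame_height n (boundary_cone n) snd"
  using tame_height_snd boundary_cube by blast+

lemma pair_homotopy_const:
  assumes "a \<in> pair_maps"
  shows "pair_homotopy snd (\<lambda>u. fst a (fst u)) (\<lambda>u. snd a (fst u))"
  unfolding pair_homotopy_def using pair_mapsD[OF assms] tame_snd
  by (auto intro: cube.cylinder_coarse_const boundary.cylinder_coarse_const)

lemma pair_rel_refl: "a \<in> pair_maps \<Longrightarrow> (a, a) \<in> pair_rel"
  by (rule pair_relI[OF _ _ pair_homotopy_const]) auto

lemma pair_rel_sym:
  assumes "(a, b) \<in> pair_rel"
  shows "(b, a) \<in> pair_rel"
proof -
  obtain q H HA where ab: "a \<in> pair_maps" "b \<in> pair_maps" and h: "pair_homotopy q H HA"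
    and e: "\<And>z. z \<in> cube_cone n \<Longrightarrow> H (z, 0) = fst a z \<and> H (z, q z + 1) = fst b z"
    "\<And>z. z \<in> boundary_cone n \<Longrightarrow> HA (z, 0) = snd a z \<and> HA (z, q z + 1) = snd b z"
    using assms unfolding pair_rel_def by auto
  note h' = pair_homotopyD[OF h]
  have "pair_homotopy q (\<lambda>u. H (fst u, q (fst u) + 1 - snd u)) (\<lambda>u. HA (fst u, q (fst u) + 1 - snd u))"
    unfolding pair_homotopy_def using h'
    by (auto intro: cube.cylinder_coarse_reverse boundary.cylinder_coarse_reverse)
  then show ?thesis using e by (intro pair_relI[OF ab(2,1)]) auto
qed

lemma pair_rel_trans:
  assumes "(a, b) \<in> pair_rel" "(b, c) \<in> pair_rel"
  shows "(a, c) \<in> pair_rel"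
proof -
  obtain q H HA where ab: "a \<in> pair_maps" "b \<in> pair_maps" and h: "pair_homotopy q H HA"
    and e: "\<And>z. z \<in> cube_cone n \<Longrightarrow> H (z, 0) = fst a z \<and> H (z, q z + 1) = fst b z"
    "\<And>z. z \<in> boundary_cone n \<Longrightarrow> HA (z, 0) = snd a z \<and> HA (z, q z + 1) = snd b z"
    using assms(1) unfolding pair_rel_def by auto
  obtain q' H' HA' where c: "c \<in> pair_maps" and g: "pair_homotopy q' H' HA'"
    and e': "\<And>z. z \<in> cube_cone n \<Longrightarrow> H' (z, 0) = fst b z \<and> H' (z, q' z + 1) = fst c z"
    "\<And>z. z \<in> boundary_cone n \<Longrightarrow> HA' (z, 0) = snd b z \<and> HA' (z, q' z + 1) = snd c z"
    using assms(2) unfolding pair_rel_def by auto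
  note h' = pair_homotopyD[OF h] and g' = pair_homotopyD[OF g]
  have nonneg: "0 \<le> q z" "0 \<le> q' z" if "z \<in> cube_cone n" for z
    using tame_height_nonneg h'(1) g'(1) that by blast+
  have "pair_homotopy (\<lambda>z. q z + q' z + 1)
      (\<lambda>u. if snd u \<le> q (fst u) + 1 then H u else H' (fst u, snd u - q (fst u) - 1))
      (\<lambda>u. if snd u \<le> q (fst u) + 1 then HA u else HA' (fst u, snd u - q (fst u) - 1))"
    unfolding pair_homotopy_def
  proof (intro conjI)
    show "tame_height n (cube_cone n) (\<lambda>z. q z + q' z + 1)"
      by (rule tame_height_add[OF h'(1) g'(1)]) simp
    show "cube.cylinder_coarse (\<lambda>z. q z + q' z + 1)
      (\<lambda>u. if snd u \<le> q (fst u) + 1 then H u else H' (fst u, snd u - q (fst u) - 1))"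
      by (rule cube.cylinder_coarse_join[OF h'(1) g'(1) h'(3) g'(3)]) (simp add: e e')
    show "boundary.cylinder_coarse (\<lambda>z. q z + q' z + 1)
      (\<lambda>u. if snd u \<le> q (fst u) + 1 then HA u else HA' (fst u, snd u - q (fst u) - 1))"
      by (rule boundary.cylinder_coarse_join[OF h'(2) g'(2) h'(4) g'(4)]) (simp add: e e')
  qed (use h'(5,6) g'(5,6) in auto)
  moreover have "\<not> q z + q' z + 1 + 1 \<le> q z + 1" "0 \<le> q z + 1" if "z \<in> cube_cone n" for z
    using nonneg[OF that] by auto
  ultimately show ?thesis using e e' boundary_cube
    by (intro pair_relI[OF ab(1) c]) (auto simp: subset_iff algebra_simps)
qed

lemma equiv_pair_rel: "equiv pair_maps pair_rel"
proof (rule equivI)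
  show "pair_rel \<subseteq> pair_maps \<times> pair_maps" unfolding pair_rel_def by auto
  show "refl_on pair_maps pair_rel" unfolding refl_on_def using pair_rel_refl by blast
  show "sym pair_rel" unfolding sym_def using pair_rel_sym by blast
  show "trans pair_rel" unfolding trans_def using pair_rel_trans by blast
qed

definition pair_concat :: "nat \<Rightarrow> ('a, 'b) pair_map \<Rightarrow> ('a, 'b) pair_map \<Rightarrow> ('a, 'b) pair_map" where
  "pair_concat j a b = (cube.concat_on j (fst a) (fst b), boundary.concat_on j (snd a) (snd b))"

definition pair_pull :: "nat \<Rightarrow> (real \<Rightarrow> real \<Rightarrow> real) \<Rightarrow> ('a, 'b) pair_map \<Rightarrow> ('a, 'b) pair_map" where
  "pair_pull j s a = (cube.pull j s (fst a), boundary.pull j s (snd a))"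

definition pair_unit :: "('a, 'b) pair_map" where
  "pair_unit = (restrict (\<lambda>z. k (i0 (snd z))) (cube_cone n), restrict (\<lambda>z. i0 (snd z)) (boundary_cone n))"

lemma pair_unit_maps: "pair_unit \<in> pair_maps"
proof -
  have "cube.cone_coarse (restrict (\<lambda>z. k (i0 (snd z))) (cube_cone n))"
    by (rule height_coarse_cong[OF cube.cone_coarse_base]) simp
  moreover have "boundary.cone_coarse (restrict (\<lambda>z. i0 (snd z)) (boundary_cone n))"
    by (rule height_coarse_cong[OF boundary.cone_coarse_base]) simp
  ultimately show ?thesis
    unfolding pair_maps_def pair_unit_def using boundary_cube P_boundary by (auto simp: subset_iff)
qed

lemma pair_concat_maps:
  assumes "a \<in> pair_maps" "b \<in> pair_maps" "j \<in> J"
  shows "pair_concat j a b \<in> pair_maps"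
proof -
  note a = pair_mapsD[OF assms(1)] and b = pair_mapsD[OF assms(2)]
  have "fst (pair_concat j a b) z = k (snd (pair_concat j a b) z)" if z: "z \<in> boundary_cone n" for z
  proof -
    have "z \<in> cube_cone n" using z boundary_cube by blast
    then show ?thesis using z boundary.half_D[OF z assms(3)] a(5) b(5)
      by (simp add: pair_concat_def coord_concat_def)
  qed
  moreover have "snd (pair_concat j a b) z = i0 (snd z)" if z: "z \<in> P" for z
    using boundary.half_P[OF z assms(3)] a(6) b(6) z P_boundary
    by (auto simp add: pair_concat_def coord_concat_def)
  moreover have "cube.cone_coarse (fst (pair_concat j a b))"
    unfolding pair_concat_def using cube.cone_coarse_concat[OF a(3,7) b(3,7) assms(3)] by simp
  moreover have "boundary.cone_coarse (snd (pair_concat j a b))"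
    unfolding pair_concat_def using boundary.cone_coarse_concat[OF a(4,6) b(4,6) assms(3)] by simp
  ultimately show ?thesis unfolding pair_maps_def by (simp add: pair_concat_def)
qed

text \<open>
  Both homotopies are concatenated at once, each of them resting after its own time is up.
\<close>

lemma pair_concat_cong:
  assumes "(a, a') \<in> pair_rel" "(b, b') \<in> pair_rel" "j \<in> J"
  shows "(pair_concat j a b, pair_concat j a' b') \<in> pair_rel"
proof -
  obtain q H HA where a: "a \<in> pair_maps" "a' \<in> pair_maps" and h: "pair_homotopy q H HA"
    and e: "\<And>z. z \<in> cube_cone n \<Longrightarrow> H (z, 0) = fst a z \<and> H (z, q z + 1) = fst a' z"
    "\<And>z. z \<in> boundary_cone n \<Longrightarrow> HA (z, 0) = snd a z \<and> HA (z, q z + 1) = snd a' z"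
    using assms(1) unfolding pair_rel_def by auto
  obtain q' H' HA' where b: "b \<in> pair_maps" "b' \<in> pair_maps" and g: "pair_homotopy q' H' HA'"
    and e': "\<And>z. z \<in> cube_cone n \<Longrightarrow> H' (z, 0) = fst b z \<and> H' (z, q' z + 1) = fst b' z"
    "\<And>z. z \<in> boundary_cone n \<Longrightarrow> HA' (z, 0) = snd b z \<and> HA' (z, q' z + 1) = snd b' z"
    using assms(2) unfolding pair_rel_def by auto
  note h' = pair_homotopyD[OF h] and g' = pair_homotopyD[OF g]
  let ?q = "concat_height j q q'"
  let ?K = "\<lambda>H H' u. if fst (fst u) j \<le> snd (fst u) / 2
      then H (lower_half j (fst u), min (snd u) (q (lower_half j (fst u)) + 1))
      else H' (upper_half j (fst u), min (snd u) (q' (upper_half j (fst u)) + 1))"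
  have nonneg: "0 \<le> q (lower_half j z)" "0 \<le> q' (upper_half j z)" if "z \<in> cube_cone n" for z
    using tame_height_nonneg h'(1) g'(1) cube.half_D[OF that assms(3)] by blast+
  have K: "pair_homotopy ?q (?K H H') (?K HA HA')"
    unfolding pair_homotopy_def
  proof (intro conjI ballI)
    show "tame_height n (cube_cone n) ?q" by (rule cube.tame_height_concat[OF h'(1) g'(1) assms(3)])
    show "cube.cylinder_coarse ?q (?K H H')"
      by (rule cube.cylinder_coarse_concat[OF h'(1) g'(1) assms(3) h'(3) g'(3) h'(7) g'(7)])
    show "boundary.cylinder_coarse ?q (?K HA HA')"
      by (rule boundary.cylinder_coarse_concat[OF h'(2) g'(2) assms(3) h'(4) g'(4) h'(6) g'(6)])
    show "?K H H' (z, t) = k (?K HA HA' (z, t))"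
      if z: "z \<in> boundary_cone n" "t \<in> {0..?q z + 1}" for z t
    proof -
      have "z \<in> cube_cone n" using z boundary_cube by blast
      then show ?thesis using boundary.half_D[OF z(1) assms(3)] z(2) nonneg[of z]
        h'(5)[of "lower_half j z" "min t (q (lower_half j z) + 1)"]
        g'(5)[of "upper_half j z" "min t (q' (upper_half j z) + 1)"] by auto
    qed
    show "?K HA HA' (z, t) = i0 (snd z)" if z: "z \<in> P" "t \<in> {0..?q z + 1}" for z t
    proof -
      have "z \<in> cube_cone n" using z P_boundary boundary_cube by blast
      then show ?thesis using boundary.half_P[OF z(1) assms(3)] z(2) nonneg[of z]
        h'(6)[of "lower_half j z" "min t (q (lower_half j z) + 1)"]
        g'(6)[of "upper_half j z" "min t (q' (upper_half j z) + 1)"] by auto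
    qed
  qed
  have clamp: "min 0 (q (lower_half j z) + 1) = 0" "min 0 (q' (upper_half j z) + 1) = 0"
    "min (?q z + 1) (q (lower_half j z) + 1) = q (lower_half j z) + 1"
    "min (?q z + 1) (q' (upper_half j z) + 1) = q' (upper_half j z) + 1" if "z \<in> cube_cone n" for z
    using nonneg[OF that] unfolding concat_height_def by auto
  show ?thesis
  proof (rule pair_relI[OF pair_concat_maps[OF a(1) b(1) assms(3)] pair_concat_maps[OF a(2) b(2) assms(3)] K])
    show "?K H H' (z, 0) = fst (pair_concat j a b) z \<and> ?K H H' (z, ?q z + 1) = fst (pair_concat j a' b') z"
      if z: "z \<in> cube_cone n" for z
      using e(1)[OF cube.half_D(1)[OF z assms(3)]] e'(1)[OF cube.half_D(2)[OF z assms(3)]] z clamp[OF z]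
      by (simp add: pair_concat_def coord_concat_def)
    show "?K HA HA' (z, 0) = snd (pair_concat j a b) z \<and> ?K HA HA' (z, ?q z + 1) = snd (pair_concat j a' b') z"
      if z: "z \<in> boundary_cone n" for z
      using e(2)[OF boundary.half_D(1)[OF z assms(3)]] e'(2)[OF boundary.half_D(2)[OF z assms(3)]] z
        clamp[of z] boundary_cube
      by (auto simp add: pair_concat_def coord_concat_def)
  qed
qed

lemma pair_pull_maps:
  assumes "a \<in> pair_maps" "j \<in> J" "reparametrization s"
  shows "pair_pull j s a \<in> pair_maps"
proof -
  note a = pair_mapsD[OF assms(1)]
  have "cube.cone_coarse (cube.pull j s (fst a))"
    by (rule height_coarse_cong[OF cube.cone_coarse_reparam[OF a(3) assms(2,3)]]) simp
  moreover have "boundary.cone_coarse (boundary.pull j s (snd a))"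
    by (rule height_coarse_cong[OF boundary.cone_coarse_reparam[OF a(4) assms(2,3)]]) simp
  moreover have "cube.pull j s (fst a) z = k (boundary.pull j s (snd a) z)" if "z \<in> boundary_cone n" for z
    using that a(5) boundary.reparam_D[OF that assms(2,3)] boundary_cube by auto
  moreover have "boundary.pull j s (snd a) z = i0 (snd z)" if "z \<in> P" for z
    using that a(6) boundary.reparam_P[OF that assms(2,3)] P_boundary by auto
  ultimately show ?thesis unfolding pair_maps_def pair_pull_def by simp
qed

text \<open>
  At the final time \<open>snd z + 1\<close> the slide has arrived, as \<open>s0\<close> and \<open>s1\<close> both take values in \<open>[0, h]\<close>.
\<close>

lemma pair_rel_pull:
  assumes a: "a \<in> pair_maps" and j: "j \<in> J" and s: "reparametrization s0" "reparametrization s1"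
    "\<And>h. 0 \<le> h \<Longrightarrow> s0 0 h = s1 0 h \<and> s0 h h = s1 h h"
  shows "(pair_pull j s0 a, pair_pull j s1 a) \<in> pair_rel"
proof -
  note a' = pair_mapsD[OF a]
  let ?H = "\<lambda>f u. f (reparam j (slide s0 s1 (snd u)) (fst u))"
  have h: "pair_homotopy snd (?H (fst a)) (?H (snd a))"
    unfolding pair_homotopy_def
    using tame_snd cube.cylinder_coarse_slide[OF a'(3) j s] boundary.cylinder_coarse_slide[OF a'(4) j s]
      a'(5)[OF boundary.slide_D[OF s _ j]] a'(6)[OF boundary.slide_P[OF s _ j]] by simp
  have finish: "reparam j (slide s0 s1 (snd z + 1)) z = reparam j s1 z" if z: "z \<in> cube_cone n" for z
  proof (rule reparam_cong)
    have "0 \<le> s (fst z j) (snd z) \<and> s (fst z j) (snd z) \<le> snd z" if "reparametrization s" for s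
      using that cube.D_coord[OF z j] unfolding reparametrization_def by blast
    from this[OF s(1)] this[OF s(2)]
    show "slide s0 s1 (snd z + 1) (fst z j) (snd z) = s1 (fst z j) (snd z)" unfolding slide_def by linarith
  qed
  show ?thesis
    by (rule pair_relI[OF pair_pull_maps[OF a j s(1)] pair_pull_maps[OF a j s(2)] h])
      (use finish boundary_cube in \<open>auto simp: pair_pull_def slide_start subset_iff\<close>)
qed

lemma pair_rel_close:
  assumes a: "a \<in> pair_maps" and b: "b \<in> pair_maps"
    and close: "{(fst a z, fst b z) | z. z \<in> cube_cone n} \<in> entourages X"
      "{(snd a z, snd b z) | z. z \<in> boundary_cone n} \<in> entourages A"
  shows "(a, b) \<in> pair_rel"
proof -
  note a' = pair_mapsD[OF a] and b' = pair_mapsD[OF b]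
  have h: "pair_homotopy snd (\<lambda>u. if snd u < snd (fst u) + 1 then fst a (fst u) else fst b (fst u))
      (\<lambda>u. if snd u < snd (fst u) + 1 then snd a (fst u) else snd b (fst u))"
    unfolding pair_homotopy_def
    using tame_snd cube.cylinder_coarse_close[OF a'(3) b'(3) close(1)]
      boundary.cylinder_coarse_close[OF a'(4) b'(4) close(2)] a'(5,6) b'(5,6) by simp
  have "0 < snd z + 1" if "z \<in> cube_cone n" for z
    using cube.D_height[OF that] by linarith
  then show ?thesis using boundary_cube by (intro pair_relI[OF a b h]) auto
qed

lemma pair_pull_ident:
  assumes "a \<in> pair_maps"
  shows "pair_pull j (\<lambda>x h. x) a = a"
  unfolding pair_pull_def cube.pull_ident[OF pair_mapsD(1)[OF assms]]
    boundary.pull_ident[OF pair_mapsD(2)[OF assms]] by simp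

text \<open>
  The reparametrization that waits at 0 is homotopic to the identity, and pulling \<open>a\<close> back along it gives a map
  close, in general not equal, to the concatenation with the unit.
\<close>

lemma pair_concat_unit_left:
  assumes a: "a \<in> pair_maps" and j: "j \<in> J"
  shows "(pair_concat j pair_unit a, a) \<in> pair_rel"
proof -
  note a' = pair_mapsD[OF a]
  have "(pair_concat j pair_unit a, pair_pull j (\<lambda>x h. max (2 * x - h) 0) a) \<in> pair_rel"
    by (rule pair_rel_close[OF pair_concat_maps[OF pair_unit_maps a j]
          pair_pull_maps[OF a j reparametrization_halves(2)]])
      (use cube.close_unit_left[OF a'(3,7) j, of "fst pair_unit"]
        boundary.close_unit_left[OF a'(4,6) j, of "snd pair_unit"]
        in \<open>auto simp: pair_concat_def pair_pull_def pair_unit_def\<close>)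
  moreover have "(pair_pull j (\<lambda>x h. max (2 * x - h) 0) a, pair_pull j (\<lambda>x h. x) a) \<in> pair_rel"
    by (rule pair_rel_pull[OF a j reparametrization_halves(2) reparametrization_ident]) auto
  ultimately show ?thesis using pair_rel_trans pair_pull_ident[OF a] by metis
qed

lemma pair_concat_unit_right:
  assumes a: "a \<in> pair_maps" and j: "j \<in> J"
  shows "(pair_concat j a pair_unit, a) \<in> pair_rel"
proof -
  note a' = pair_mapsD[OF a]
  have "(pair_concat j a pair_unit, pair_pull j (\<lambda>x h. min (2 * x) h) a) \<in> pair_rel"
    by (rule pair_rel_close[OF pair_concat_maps[OF a pair_unit_maps j]
          pair_pull_maps[OF a j reparametrization_halves(1)]])
      (use cube.close_unit_right[OF a'(3,7) j, of "fst pair_unit"]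
        boundary.close_unit_right[OF a'(4,6) j, of "snd pair_unit"]
        in \<open>auto simp: pair_concat_def pair_pull_def pair_unit_def\<close>)
  moreover have "(pair_pull j (\<lambda>x h. min (2 * x) h) a, pair_pull j (\<lambda>x h. x) a) \<in> pair_rel"
    by (rule pair_rel_pull[OF a j reparametrization_halves(1) reparametrization_ident]) auto
  ultimately show ?thesis using pair_rel_trans pair_pull_ident[OF a] by metis
qed

text \<open>
  The folding map agrees at both ends with the constant \<open>h\<close>. Sliding one to the other deforms the
  concatenation to the pullback of \<open>a\<close> along the projection to the face \<open>x\<^sub>j = h\<close>, which is close
  to the unit.
\<close>

lemma pair_concat_inverse:
  assumes a: "a \<in> pair_maps" and j: "j \<in> J"
  shows "(pair_concat j (pair_pull j (\<lambda>x h. h - x) a) a, pair_unit) \<in> pair_rel"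
proof -
  note a' = pair_mapsD[OF a]
  have "pair_concat j (pair_pull j (\<lambda>x h. h - x) a) a = pair_pull j (\<lambda>x h. \<bar>2 * x - h\<bar>) a"
    unfolding pair_concat_def pair_pull_def fst_conv snd_conv
      cube.concat_on_inverse[OF j] boundary.concat_on_inverse[OF j] ..
  moreover have "(pair_pull j (\<lambda>x h. \<bar>2 * x - h\<bar>) a, pair_pull j (\<lambda>x h. h) a) \<in> pair_rel"
    by (rule pair_rel_pull[OF a j reparametrization_fold reparametrization_top]) auto
  moreover have "(pair_pull j (\<lambda>x h. h) a, pair_unit) \<in> pair_rel"
    by (rule pair_rel_close[OF pair_pull_maps[OF a j reparametrization_top] pair_unit_maps])
      (use cube.close_top_face[OF a'(3,7) j, of "fst pair_unit"]
        boundary.close_top_face[OF a'(4,6) j, of "snd pair_unit"]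
        in \<open>auto simp: pair_pull_def pair_unit_def\<close>)
  ultimately show ?thesis using pair_rel_trans by metis
qed

lemma pair_concat_assoc:
  assumes "a \<in> pair_maps" "b \<in> pair_maps" "c \<in> pair_maps" and j: "j \<in> J"
  shows "(pair_concat j (pair_concat j a b) c, pair_concat j a (pair_concat j b c)) \<in> pair_rel"
proof -
  have m: "pair_concat j (pair_concat j a b) c \<in> pair_maps"
    using assms pair_concat_maps by blast
  have "pair_pull j assoc_shift (pair_concat j (pair_concat j a b) c) = pair_concat j a (pair_concat j b c)"
    unfolding pair_concat_def pair_pull_def fst_conv snd_conv
      cube.concat_on_assoc[OF j] boundary.concat_on_assoc[OF j] ..
  moreover have "(pair_pull j (\<lambda>x h. x) (pair_concat j (pair_concat j a b) c),
      pair_pull j assoc_shift (pair_concat j (pair_concat j a b) c)) \<in> pair_rel"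
    by (rule pair_rel_pull[OF m j reparametrization_ident reparametrization_assoc])
      (simp add: assoc_shift_def)
  ultimately show ?thesis using pair_pull_ident[OF m] by simp
qed

lemma pair_concat_interchange:
  assumes "i \<in> J" "j \<in> J" "i \<noteq> j"
  shows "pair_concat i (pair_concat j a b) (pair_concat j a' b')
    = pair_concat j (pair_concat i a a') (pair_concat i b b')"
  unfolding pair_concat_def fst_conv snd_conv
    cube.concat_on_interchange[OF assms] boundary.concat_on_interchange[OF assms] ..

text \<open>
  Eckmann--Hilton: insert units in direction \<open>j\<close>, interchange, and remove units in direction \<open>i\<close>. Depending on
  the side where the units go in, concatenation in direction \<open>i\<close> becomes concatenation in
  direction \<open>j\<close> in the same or in the opposite order.
\<close>

lemma pair_concat_commute:
  assumes a: "a \<in> pair_maps" and b: "b \<in> pair_maps" and ij: "i \<in> J" "j \<in> J" "i \<noteq> j"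
  shows "(pair_concat i a b, pair_concat i b a) \<in> pair_rel"
proof -
  let ?e = pair_unit
  note e = pair_unit_maps and c = pair_concat_cong and sym = pair_rel_sym
    and ul = pair_concat_unit_left and ur = pair_concat_unit_right
  have one: "(pair_concat i a b, pair_concat j a b) \<in> pair_rel" if "a \<in> pair_maps" "b \<in> pair_maps" for a b
  proof -
    have "(pair_concat i a b, pair_concat i (pair_concat j a ?e) (pair_concat j ?e b)) \<in> pair_rel"
      using that ij by (intro c sym[OF ur] sym[OF ul])
    moreover have "(pair_concat j (pair_concat i a ?e) (pair_concat i ?e b), pair_concat j a b) \<in> pair_rel"
      using that ij by (intro c ur ul)
    ultimately show ?thesis unfolding pair_concat_interchange[OF ij] by (rule pair_rel_trans)
  qed
  have two: "(pair_concat i a b, pair_concat j b a) \<in> pair_rel"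
  proof -
    have "(pair_concat i a b, pair_concat i (pair_concat j ?e a) (pair_concat j b ?e)) \<in> pair_rel"
      using a b ij by (intro c sym[OF ur] sym[OF ul])
    moreover have "(pair_concat j (pair_concat i ?e b) (pair_concat i a ?e), pair_concat j b a) \<in> pair_rel"
      using a b ij by (intro c ur ul)
    ultimately show ?thesis unfolding pair_concat_interchange[OF ij] by (rule pair_rel_trans)
  qed
  show ?thesis by (rule pair_rel_trans[OF two sym[OF one[OF b a]]])
qed

end

section \<open>Groups of classes\<close>

text \<open>
  A union over all representatives. It is a single class when \<open>c\<close> respects \<open>R\<close>
  (\<open>class_mult_eq\<close>).
\<close>

definition class_mult :: "('m \<times> 'm) set \<Rightarrow> ('m \<Rightarrow> 'm \<Rightarrow> 'm) \<Rightarrow> 'm set \<Rightarrow> 'm set \<Rightarrow> 'm set" where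
  "class_mult R c = (\<lambda>a b. \<Union>F\<in>a. \<Union>G\<in>b. R `` {c F G})"

locale group_up_to =
  fixes M :: "'m set" and R :: "('m \<times> 'm) set" and c :: "'m \<Rightarrow> 'm \<Rightarrow> 'm" and e :: 'm
  assumes equiv: "equiv M R"
    and closed: "a \<in> M \<Longrightarrow> b \<in> M \<Longrightarrow> c a b \<in> M"
    and unit_in: "e \<in> M"
    and cong: "(a, a') \<in> R \<Longrightarrow> (b, b') \<in> R \<Longrightarrow> (c a b, c a' b') \<in> R"
    and assoc: "a \<in> M \<Longrightarrow> b \<in> M \<Longrightarrow> d \<in> M \<Longrightarrow> (c (c a b) d, c a (c b d)) \<in> R"
    and left_unit: "a \<in> M \<Longrightarrow> (c e a, a) \<in> R"
    and left_inverse: "a \<in> M \<Longrightarrow> \<exists>b\<in>M. (c b a, e) \<in> R"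
begin

lemma class_mult_eq:
  assumes "a \<in> M" "b \<in> M"
  shows "class_mult R c (R `` {a}) (R `` {b}) = R `` {c a b}"
proof -
  have "R `` {c a' b'} = R `` {c a b}" if "a' \<in> R `` {a}" "b' \<in> R `` {b}" for a' b'
    using that cong[of a a' b b'] equiv_class_eq[OF equiv] by auto
  moreover have "a \<in> R `` {a}" "b \<in> R `` {b}" using assms equiv_class_self[OF equiv] by blast+
  ultimately show ?thesis unfolding class_mult_def by blast
qed

lemma class_eq: "(a, b) \<in> R \<Longrightarrow> R `` {a} = R `` {b}"
  by (rule equiv_class_eq[OF equiv])

lemma group_classes: "group \<lparr>carrier = M // R, mult = class_mult R c, one = R `` {e}\<rparr>"
proof (rule groupI)
  let ?G = "\<lparr>carrier = M // R, mult = class_mult R c, one = R `` {e}\<rparr>"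
  show "\<one>\<^bsub>?G\<^esub> \<in> carrier ?G" using unit_in by (simp add: quotientI)
  fix x assume "x \<in> carrier ?G"
  then obtain a where a: "a \<in> M" "x = R `` {a}" by (auto elim: quotientE)
  show "\<one>\<^bsub>?G\<^esub> \<otimes>\<^bsub>?G\<^esub> x = x"
    using a class_mult_eq[OF unit_in a(1)] class_eq[OF left_unit[OF a(1)]] by simp
  obtain b where b: "b \<in> M" "(c b a, e) \<in> R" using left_inverse[OF a(1)] by blast
  have "R `` {b} \<otimes>\<^bsub>?G\<^esub> x = \<one>\<^bsub>?G\<^esub>"
    using a class_mult_eq[OF b(1) a(1)] class_eq[OF b(2)] by simp
  then show "\<exists>y\<in>carrier ?G. y \<otimes>\<^bsub>?G\<^esub> x = \<one>\<^bsub>?G\<^esub>" using b(1) quotientI[of b M R] by auto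
  fix y assume "y \<in> carrier ?G"
  then obtain b where b: "b \<in> M" "y = R `` {b}" by (auto elim: quotientE)
  show "x \<otimes>\<^bsub>?G\<^esub> y \<in> carrier ?G"
    using a b closed by (simp add: class_mult_eq quotientI)
  fix z assume "z \<in> carrier ?G"
  then obtain d where d: "d \<in> M" "z = R `` {d}" by (auto elim: quotientE)
  show "x \<otimes>\<^bsub>?G\<^esub> y \<otimes>\<^bsub>?G\<^esub> z = x \<otimes>\<^bsub>?G\<^esub> (y \<otimes>\<^bsub>?G\<^esub> z)"
    using a b d closed class_eq[OF assoc[OF a(1) b(1) d(1)]] by (simp add: class_mult_eq)
qed

lemma comm_group_classes:
  assumes "\<And>a b. a \<in> M \<Longrightarrow> b \<in> M \<Longrightarrow> (c a b, c b a) \<in> R"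
  shows "comm_group \<lparr>carrier = M // R, mult = class_mult R c, one = R `` {e}\<rparr>"
proof (rule group.group_comm_groupI[OF group_classes])
  let ?G = "\<lparr>carrier = M // R, mult = class_mult R c, one = R `` {e}\<rparr>"
  fix x y assume "x \<in> carrier ?G" "y \<in> carrier ?G"
  then obtain a b where "a \<in> M" "x = R `` {a}" "b \<in> M" "y = R `` {b}" by (auto elim!: quotientE)
  then show "x \<otimes>\<^bsub>?G\<^esub> y = y \<otimes>\<^bsub>?G\<^esub> x" using class_eq[OF assms[of a b]] by (simp add: class_mult_eq)
qed

end

lemma (in pair_setting) group_up_to_pair:
  assumes "j \<in> J"
  shows "group_up_to pair_maps pair_rel (pair_concat j) pair_unit"
proof
  show "\<exists>b\<in>pair_maps. (pair_concat j b a, pair_unit) \<in> pair_rel" if "a \<in> pair_maps" for a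
    using pair_concat_inverse[OF that assms] pair_pull_maps[OF that assms reparametrization_flip]
    by blast
qed (fact equiv_pair_rel pair_unit_maps | rule pair_concat_maps pair_concat_cong pair_concat_assoc
    pair_concat_unit_left; (assumption | rule assms))+

text \<open>
  Carries the laws for maps of pairs back to absolute maps, which correspond bijectively to the maps of
  pairs with prescribed second component.
\<close>

lemma group_up_to_reflect:
  assumes g: "group_up_to M R c e"
    and maps: "\<And>a. a \<in> N \<longleftrightarrow> f a \<in> M" and surj: "\<And>b. b \<in> M \<Longrightarrow> \<exists>a. b = f a"
    and S: "\<And>a b. (a, b) \<in> S \<longleftrightarrow> (f a, f b) \<in> R"
    and c: "\<And>a b. a \<in> N \<Longrightarrow> b \<in> N \<Longrightarrow> f (d a b) = c (f a) (f b)" and u: "f u = e"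
  shows "group_up_to N S d u"
proof -
  interpret group_up_to M R c e by (rule g)
  have R: "R \<subseteq> M \<times> M" using equiv unfolding equiv_def by blast
  have SN: "a \<in> N \<and> b \<in> N" if "(a, b) \<in> S" for a b using that R unfolding S maps by blast
  show ?thesis
  proof
    show "equiv N S"
    proof (rule equivI)
      show "S \<subseteq> N \<times> N" using SN by auto
      have R: "refl_on M R" "sym R" "trans R" using equiv by (auto elim: equivE)
      show "refl_on N S"
      proof (rule refl_onI)
        fix a assume "a \<in> N"
        then show "(a, a) \<in> S" unfolding S maps by (rule refl_onD[OF R(1)])
      qed
      show "sym S" by (rule symI) (unfold S, rule symD[OF R(2)])
      show "trans S" by (rule transI) (unfold S, rule transD[OF R(3)])
    qed
    show dcl: "d a b \<in> N" if "a \<in> N" "b \<in> N" for a b using that closed c unfolding maps by simp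
    show "u \<in> N" using unit_in unfolding maps u .
    show "(d a b, d a' b') \<in> S" if "(a, a') \<in> S" "(b, b') \<in> S" for a a' b b'
      using that cong SN[OF that(1)] SN[OF that(2)] unfolding S by (simp add: c)
    show "(d (d a b) x, d a (d b x)) \<in> S" if "a \<in> N" "b \<in> N" "x \<in> N" for a b x
      using that assoc[of "f a" "f b" "f x"] dcl unfolding S by (simp add: c maps[symmetric])
    show "(d u a, a) \<in> S" if "a \<in> N" for a
      using that left_unit[of "f a"] unit_in unfolding S by (simp add: c maps u)
    show "\<exists>b\<in>N. (d b a, u) \<in> S" if a: "a \<in> N" for a
    proof -
      obtain b where b: "b \<in> M" "(c b (f a), e) \<in> R" using left_inverse a maps by blast
      then obtain b' where "b = f b'" using surj by blast
      then show ?thesis using b a unfolding S by (intro bexI[of _ b']) (auto simp: c u maps)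
    qed
  qed
qed

section \<open>The absolute and the relative groups\<close>

lemma face_move:
  assumes "z \<in> cube_cone n" "j < n" "0 \<le> R" "fst z j \<le> R \<or> snd z - fst z j \<le> R"
  obtains r where "r = 0 \<or> r = snd z" "\<bar>fst z j - r\<bar> \<le> R" "0 \<le> r" "r \<le> snd z"
proof -
  have "0 \<le> fst z j" "fst z j \<le> snd z" "0 \<le> snd z" using assms(1,2) unfolding cube_cone_iff by auto
  then show thesis using assms(4) that[of 0] that[of "snd z"] by auto
qed

lemma pair_setting_absolute:
  assumes n: "n \<ge> 1" and X: "coarse_space X" and i0: "coarse_map rplus X i0"
  shows "pair_setting n (boundary_cone n) {..<n} X X (\<lambda>x. x) i0"
proof
  have "{(x, y) | x y. (x, y) \<in> M} = M" for M :: "('a \<times> 'a) set" by auto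
  moreover have "{x \<in> carrier X. x \<in> B} = B" if "coarsely_bounded X B" for B
    using that unfolding coarsely_bounded_def by auto
  ultimately show "coarse_pair X X (\<lambda>x. x)"
    unfolding coarse_pair_def coarse_map_def controlled_map_def using X by auto
  show "set_coord j r z \<in> boundary_cone n"
    if "z \<in> boundary_cone n" "j \<in> {..<n}" "0 \<le> r" "r \<le> snd z" "fst z j \<in> {0, snd z} \<longrightarrow> r \<in> {0, snd z}" for z j r
    using boundary_cone_set_coord[OF n that(1) _ that(3-5)] that(2) by simp
  show "\<exists>w\<in>boundary_cone n. cone_dist n z w \<le> R + 1"
    if z: "z \<in> cube_cone n" and j: "j \<in> {..<n}" and R: "0 \<le> R" "fst z j \<le> R \<or> snd z - fst z j \<le> R" for z j R
  proof -
    have jn: "j < n" using j by simp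
    obtain r where r: "r = 0 \<or> r = snd z" "\<bar>fst z j - r\<bar> \<le> R" "0 \<le> r" "r \<le> snd z"
      using face_move[OF z jn R] by blast
    have "set_coord j r z \<in> boundary_cone n"
      unfolding boundary_cone_iff[OF n] using z jn r unfolding cube_cone_iff
      by (auto simp: set_coord_def intro!: exI[of _ j])
    moreover have "cone_dist n z (set_coord j r z) \<le> R + 1"
      using cone_dist_set_coord[of n j "fst z j" z r z] r by simp
    ultimately show ?thesis by blast
  qed
qed (use n i0 in auto)

lemma pair_setting_relative:
  assumes n: "n \<ge> 2" and pair: "coarse_pair X A k" and i0: "coarse_map rplus A i0"
  shows "pair_setting n (boundary_plus_cone n) {..<n - 1} X A k i0"
proof
  show n1: "n \<ge> 1" using n by simp
  note iff = boundary_plus_cone_iff[OF n1] boundary_cone_iff[OF n1]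
  show "boundary_plus_cone n \<subseteq> boundary_cone n" using iff by blast
  show "set_coord j r z \<in> boundary_plus_cone n"
    if "z \<in> boundary_plus_cone n" "j \<in> {..<n - 1}" "0 \<le> r" "r \<le> snd z" "fst z j \<in> {0, snd z} \<longrightarrow> r \<in> {0, snd z}" for z j r
  proof -
    have z: "z \<in> boundary_cone n" "fst z (n - 1) > 0 \<or> snd z = 0"
      using that(1) unfolding boundary_plus_cone_iff[OF n1] by auto
    have "j < n" "n - 1 \<noteq> j" using that(2) by auto
    then show ?thesis
      using boundary_cone_set_coord[OF n1 z(1) _ that(3-5)] z(2)
      unfolding boundary_plus_cone_iff[OF n1] by simp
  qed
  show "\<exists>w\<in>boundary_plus_cone n. cone_dist n z w \<le> R + 1"
    if z: "z \<in> cube_cone n" and j: "j \<in> {..<n - 1}" and R: "0 \<le> R" "fst z j \<le> R \<or> snd z - fst z j \<le> R" for z j R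
  proof -
    have jn: "j < n" "j \<noteq> n - 1" using j by auto
    obtain r where r: "r = 0 \<or> r = snd z" "\<bar>fst z j - r\<bar> \<le> R" "0 \<le> r" "r \<le> snd z"
      using face_move[OF z jn(1) R] by blast
    \<comment> \<open>Besides moving \<open>z\<close> onto the face, raise its last coordinate by at most 1 to make it positive;
      over height 0 this is impossible, but the apex belongs to the cone anyway.\<close>
    let ?m = "max (fst z (n - 1)) (min 1 (snd z))"
    let ?w = "set_coord (n - 1) ?m (set_coord j r z)"
    have zn: "0 \<le> snd z" "0 \<le> fst z (n - 1)" "fst z (n - 1) \<le> snd z" using z n1 unfolding cube_cone_iff by auto
    have "?w \<in> cube_cone n" using z jn r zn n1 unfolding cube_cone_iff by (auto simp: set_coord_def)
    moreover have "fst ?w j = r" using jn by simp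
    moreover have "fst ?w (n - 1) > 0 \<or> snd ?w = 0" using zn by auto
    ultimately have "?w \<in> boundary_plus_cone n" unfolding iff using jn r(1) by auto
    moreover have "cone_dist n z ?w \<le> R + 1"
    proof -
      have "cone_dist n z ?w \<le> cone_dist n z (set_coord j r z) + \<bar>fst z (n - 1) - ?m\<bar>"
        using cone_dist_set_coord[of n "n - 1" "fst z (n - 1)" z ?m "set_coord j r z"] by simp
      moreover have "cone_dist n z (set_coord j r z) \<le> \<bar>fst z j - r\<bar>"
        using cone_dist_set_coord[of n j "fst z j" z r z] by simp
      moreover have "\<bar>fst z (n - 1) - ?m\<bar> \<le> 1" using zn by linarith
      ultimately show ?thesis using r(2) by linarith
    qed
    ultimately show ?thesis by blast
  qed
qed (use pair i0 in auto)

text \<open>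
  With \<open>P\<close> the whole boundary cone, the second component of a map of pairs is forced to be the basepoint
  path, and \<open>F \<mapsto> (F, i0 \<circ> p)\<close> identifies the absolute maps with the maps of pairs.
\<close>

lemma absolute_group_up_to:
  assumes n: "n \<ge> 1" and X: "coarse_space X" and i0: "coarse_map rplus X i0"
  shows "group_up_to (pi_maps n X i0) (pi_rel n X i0) (pi_concat n) (pi_unit n i0)"
    and "n \<ge> 2 \<Longrightarrow> F \<in> pi_maps n X i0 \<Longrightarrow> G \<in> pi_maps n X i0 \<Longrightarrow>
      (pi_concat n F G, pi_concat n G F) \<in> pi_rel n X i0"
proof -
  interpret pair_setting n "boundary_cone n" "{..<n}" X X "\<lambda>x. x" i0
    by (rule pair_setting_absolute[OF assms])
  let ?e = "restrict (\<lambda>z. i0 (snd z)) (boundary_cone n)"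
  let ?f = "\<lambda>F. (F, ?e)"
  have e: "boundary.cone_coarse ?e"
    by (rule height_coarse_cong[OF boundary.cone_coarse_base]) simp
  have maps: "F \<in> pi_maps n X i0 \<longleftrightarrow> ?f F \<in> pair_maps" for F
    unfolding pi_maps_def pair_maps_def cone_space_def cube.coarse_map_iff cone_height_def
    using e by auto
  have rel: "(F, G) \<in> pi_rel n X i0 \<longleftrightarrow> (?f F, ?f G) \<in> pair_rel" for F G
  proof
    assume "(F, G) \<in> pi_rel n X i0"
    then obtain q H where FG: "?f F \<in> pair_maps" "?f G \<in> pair_maps"
      and h: "tame_height n (cube_cone n) q" "cube.cylinder_coarse q H"
        "\<forall>z\<in>cube_cone n. H (z, 0) = F z \<and> H (z, q z + 1) = G z"
      and base: "\<forall>z\<in>boundary_cone n. \<forall>t\<in>{0..q z + 1}. H (z, t) = i0 (snd z)"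
      unfolding pi_rel_def maps cone_space_def cube.coarse_homotopy_iff cone_height_def by auto
    have "pair_homotopy q H (\<lambda>u. i0 (snd (fst u)))"
      unfolding pair_homotopy_def using h base boundary.cylinder_coarse_const[OF boundary.cone_coarse_base] by simp
    then show "(?f F, ?f G) \<in> pair_rel" using h(3) by (intro pair_relI[OF FG]) auto
  next
    assume "(?f F, ?f G) \<in> pair_rel"
    then obtain q H HA where FG: "?f F \<in> pair_maps" "?f G \<in> pair_maps" and h: "pair_homotopy q H HA"
      and ends: "\<forall>z\<in>cube_cone n. H (z, 0) = F z \<and> H (z, q z + 1) = G z"
      unfolding pair_rel_def by auto
    note h' = pair_homotopyD[OF h]
    have "coarse_homotopy (cone_space n (unit_cube n)) X q F G H"
      unfolding cone_space_def cube.coarse_homotopy_iff using h'(1,3) ends by blast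
    moreover have "\<forall>z\<in>boundary_cone n. \<forall>t\<in>{0..q z + 1}. H (z, t) = i0 (cone_height z)"
      using h'(7) unfolding cone_height_def by auto
    ultimately show "(F, G) \<in> pi_rel n X i0" unfolding pi_rel_def maps using FG by blast
  qed
  have surj: "\<exists>F. a = ?f F" if "a \<in> pair_maps" for a
  proof -
    have "snd a = ?e"
      using pair_mapsD(2,6)[OF that] by (intro extensionalityI[of _ "boundary_cone n"]) auto
    then show ?thesis by (intro exI[of _ "fst a"]) (simp add: prod_eq_iff)
  qed
  have zero: "0 \<in> {..<n}" using n by simp
  have concat: "?f (pi_concat n F G) = pair_concat 0 (?f F) (?f G)" for F G
  proof -
    have "boundary.concat_on 0 ?e ?e = ?e"
      by (rule restrict_ext) (use boundary.half_D[OF _ zero] in \<open>auto simp: coord_concat_def\<close>)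
    then show ?thesis unfolding pair_concat_def pi_concat_def cone_concat_eq by simp
  qed
  have unit: "?f (pi_unit n i0) = pair_unit"
    unfolding pi_unit_def pair_unit_def cone_height_def[abs_def] comp_def ..
  show "group_up_to (pi_maps n X i0) (pi_rel n X i0) (pi_concat n) (pi_unit n i0)"
    by (rule group_up_to_reflect[OF group_up_to_pair[OF zero], of _ ?f]) (use maps rel surj concat unit in auto)
  show "(pi_concat n F G, pi_concat n G F) \<in> pi_rel n X i0"
    if "n \<ge> 2" "F \<in> pi_maps n X i0" "G \<in> pi_maps n X i0"
    unfolding rel concat using that maps pair_concat_commute[of "?f F" "?f G" 0 1] by simp
qed

lemma relative_group_up_to:
  assumes n: "n \<ge> 2" and "coarse_pair X A k" "coarse_map rplus A i0"
  shows "group_up_to (rel_pi_maps n X A k i0) (rel_pi_rel n X A k i0) (rel_pi_concat n) (rel_pi_unit n k i0)"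
    and "n \<ge> 3 \<Longrightarrow> a \<in> rel_pi_maps n X A k i0 \<Longrightarrow> b \<in> rel_pi_maps n X A k i0 \<Longrightarrow>
      (rel_pi_concat n a b, rel_pi_concat n b a) \<in> rel_pi_rel n X A k i0"
proof -
  interpret pair_setting n "boundary_plus_cone n" "{..<n - 1}" X A k i0
    by (rule pair_setting_relative[OF assms])
  have maps: "rel_pi_maps n X A k i0 = pair_maps"
    unfolding rel_pi_maps_def pair_maps_def cone_space_def cube.coarse_map_iff boundary.coarse_map_iff
      cone_height_def by auto
  have rel: "rel_pi_rel n X A k i0 = pair_rel"
  proof -
    have "(\<exists>q H HA. coarse_homotopy (cone_space n (unit_cube n)) X q F G H \<and>
           coarse_homotopy (cone_space n (cube_boundary n)) A q FA GA HA \<and>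
           (\<forall>z\<in>boundary_cone n. \<forall>t\<in>{0..q z + 1}. H (z, t) = k (HA (z, t))) \<and>
           (\<forall>z\<in>boundary_plus_cone n. \<forall>t\<in>{0..q z + 1}. HA (z, t) = i0 (cone_height z))) \<longleftrightarrow>
        (\<exists>q H HA. pair_homotopy q H HA \<and>
          (\<forall>z\<in>cube_cone n. H (z, 0) = F z \<and> H (z, q z + 1) = G z) \<and>
          (\<forall>z\<in>boundary_cone n. HA (z, 0) = FA z \<and> HA (z, q z + 1) = GA z))" for F G FA GA
      unfolding cone_space_def cube.coarse_homotopy_iff boundary.coarse_homotopy_iff pair_homotopy_def
        cone_height_def
      using tame_height_subset[OF _ boundary_cube] by blast
    note iff = this
    show ?thesis
    proof (rule Set.set_eqI)
      fix x :: "('a, 'b) pair_map \<times> ('a, 'b) pair_map"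
      obtain F FA G GA where x: "x = ((F, FA), (G, GA))" by (metis surj_pair)
      show "x \<in> rel_pi_rel n X A k i0 \<longleftrightarrow> x \<in> pair_rel"
        unfolding x rel_pi_rel_def pair_rel_def maps mem_Collect_eq case_prod_conv fst_conv snd_conv iff ..
    qed
  qed
  have concat: "rel_pi_concat n = pair_concat 0"
    by (intro ext) (auto simp: rel_pi_concat_def pair_concat_def cone_concat_eq)
  have unit: "rel_pi_unit n k i0 = pair_unit"
    unfolding rel_pi_unit_def pair_unit_def cone_height_def[abs_def] comp_def ..
  have zero: "0 \<in> {..<n - 1}" using assms(1) by simp
  show "group_up_to (rel_pi_maps n X A k i0) (rel_pi_rel n X A k i0) (rel_pi_concat n) (rel_pi_unit n k i0)"
    unfolding maps rel concat unit by (rule group_up_to_pair[OF zero])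
  show "(rel_pi_concat n a b, rel_pi_concat n b a) \<in> rel_pi_rel n X A k i0"
    if "n \<ge> 3" "a \<in> rel_pi_maps n X A k i0" "b \<in> rel_pi_maps n X A k i0"
    using that pair_concat_commute[of a b 0 1] unfolding maps rel concat by simp
qed

lemma coarse_pi_eq:
  "coarse_pi n X i0 = \<lparr>carrier = pi_maps n X i0 // pi_rel n X i0,
    mult = class_mult (pi_rel n X i0) (pi_concat n), one = pi_rel n X i0 `` {pi_unit n i0}\<rparr>"
  unfolding coarse_pi_def class_mult_def ..

lemma rel_coarse_pi_eq:
  "rel_coarse_pi n X A k i0 = \<lparr>carrier = rel_pi_maps n X A k i0 // rel_pi_rel n X A k i0,
    mult = class_mult (rel_pi_rel n X A k i0) (rel_pi_concat n),
    one = rel_pi_rel n X A k i0 `` {rel_pi_unit n k i0}\<rparr>"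
  unfolding rel_coarse_pi_def class_mult_def ..

theorem proposition4p8:
  fixes X :: "'a coarse" and n :: nat
  assumes "coarse_space X"
  shows
    "(\<forall>i0. n \<ge> 1 \<longrightarrow> coarse_map rplus X i0 \<longrightarrow>
        equiv (pi_maps n X i0) (pi_rel n X i0) \<and>
        (\<forall>F\<in>pi_maps n X i0. \<forall>G\<in>pi_maps n X i0.
           pi_concat n F G \<in> pi_maps n X i0 \<and>
           pi_rel n X i0 `` {F} \<otimes>\<^bsub>coarse_pi n X i0\<^esub> pi_rel n X i0 `` {G}
             = pi_rel n X i0 `` {pi_concat n F G}) \<and>
        group (coarse_pi n X i0) \<and>
        pi_unit n i0 \<in> pi_maps n X i0 \<and>
        \<one>\<^bsub>coarse_pi n X i0\<^esub> = pi_rel n X i0 `` {pi_unit n i0} \<and>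
        (n \<ge> 2 \<longrightarrow> comm_group (coarse_pi n X i0)))
   \<and> (\<forall>(A :: 'b coarse) k i0. n \<ge> 2 \<longrightarrow> coarse_pair X A k \<longrightarrow> coarse_map rplus A i0 \<longrightarrow>
        equiv (rel_pi_maps n X A k i0) (rel_pi_rel n X A k i0) \<and>
        (\<forall>F\<in>rel_pi_maps n X A k i0. \<forall>G\<in>rel_pi_maps n X A k i0.
           rel_pi_concat n F G \<in> rel_pi_maps n X A k i0 \<and>
           rel_pi_rel n X A k i0 `` {F} \<otimes>\<^bsub>rel_coarse_pi n X A k i0\<^esub> rel_pi_rel n X A k i0 `` {G}
             = rel_pi_rel n X A k i0 `` {rel_pi_concat n F G}) \<and>
        group (rel_coarse_pi n X A k i0) \<and>
        (n \<ge> 3 \<longrightarrow> comm_group (rel_coarse_pi n X A k i0)))"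
proof (intro conjI allI impI ballI)
  fix i0 assume n: "n \<ge> 1" and i0: "coarse_map rplus X i0"
  interpret group_up_to "pi_maps n X i0" "pi_rel n X i0" "pi_concat n" "pi_unit n i0"
    by (rule absolute_group_up_to(1)[OF n assms i0])
  show "equiv (pi_maps n X i0) (pi_rel n X i0)" by (rule equiv)
  show "pi_unit n i0 \<in> pi_maps n X i0" by (rule unit_in)
  show "group (coarse_pi n X i0)" unfolding coarse_pi_eq by (rule group_classes)
  show "\<one>\<^bsub>coarse_pi n X i0\<^esub> = pi_rel n X i0 `` {pi_unit n i0}" unfolding coarse_pi_eq by simp
  show "comm_group (coarse_pi n X i0)" if "n \<ge> 2"
    unfolding coarse_pi_eq by (rule comm_group_classes[OF absolute_group_up_to(2)[OF n assms i0 that]])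
  fix F G assume FG: "F \<in> pi_maps n X i0" "G \<in> pi_maps n X i0"
  show "pi_concat n F G \<in> pi_maps n X i0" by (rule closed[OF FG])
  show "pi_rel n X i0 `` {F} \<otimes>\<^bsub>coarse_pi n X i0\<^esub> pi_rel n X i0 `` {G} = pi_rel n X i0 `` {pi_concat n F G}"
    unfolding coarse_pi_eq using class_mult_eq[OF FG] by simp
next
  fix A :: "'b coarse" and k i0
  assume n: "n \<ge> 2" and k: "coarse_pair X A k" and i0: "coarse_map rplus A i0"
  interpret group_up_to "rel_pi_maps n X A k i0" "rel_pi_rel n X A k i0" "rel_pi_concat n" "rel_pi_unit n k i0"
    by (rule relative_group_up_to(1)[OF n k i0])
  show "equiv (rel_pi_maps n X A k i0) (rel_pi_rel n X A k i0)" by (rule equiv)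
  show "group (rel_coarse_pi n X A k i0)" unfolding rel_coarse_pi_eq by (rule group_classes)
  show "comm_group (rel_coarse_pi n X A k i0)" if "n \<ge> 3"
    unfolding rel_coarse_pi_eq by (rule comm_group_classes[OF relative_group_up_to(2)[OF n k i0 that]])
  fix F G assume FG: "F \<in> rel_pi_maps n X A k i0" "G \<in> rel_pi_maps n X A k i0"
  show "rel_pi_concat n F G \<in> rel_pi_maps n X A k i0" by (rule closed[OF FG])
  show "rel_pi_rel n X A k i0 `` {F} \<otimes>\<^bsub>rel_coarse_pi n X A k i0\<^esub> rel_pi_rel n X A k i0 `` {G}
      = rel_pi_rel n X A k i0 `` {rel_pi_concat n F G}"
    unfolding rel_coarse_pi_eq using class_mult_eq[OF FG] by simp
qed

end
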